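(* Let $I$ be a MOMILP instance, let $\varepsilon\in\mathbb{R}_{>0}$, let $\mathsf{hpO}$ be a plane separating oracle for $I$, and let $x^{\mathrm{init}}\in X$ be a feasible solution with encoding length in $\mathcal{O}(\mathsf{poly}(\langle I\rangle))$. Then the inner approximation algorithm described in the context (run with $I$, $x^{\mathrm{init}}$, $\varepsilon$ and $\mathsf{hpO}$) has a running time in $\mathcal{O}(\mathsf{poly}(\langle I\rangle,\varepsilon^{-1},T_{\mathsf{hpO}}))$, where $T_{\mathsf{hpO}}$ is an upper bound on the running time of the plane separating oracle.
   Context: MOMILP. For $d,m,n\in\mathbb{N}_{>0}$, $Q\in\mathbb{Q}^{d\times n}$, $A\in\mathbb{Q}^{m\times n}$, $b\in\mathbb{Q}^m$ and $n_{\mathbb{R}},n_{\mathbb{Z}}\in\mathbb{N}_{\ge 0}$ with $n_{\mathbb{R}}+n_{\mathbb{Z}}=n$, a multi-objective mixed-integer linear program (MOMILP) is the problem $\min f(x)=Qx$ subject to $Ax\ge b$, $x\in\mathbb{R}^{n_{\mathbb{R}}}\times\mathbb{Z}^{n_{\mathbb{Z}}}$. $X$ denotes its set of feasible solutions and $Y=\{f(x):x\in X\}\subseteq\mathbb{R}^d$ its set of images. An instance $I$ need not be explicitly encoded in this form. Standing assumptions: $X\ne\emptyset$, $Y\subseteq\mathbb{R}^d_{\ge 0}$, and the number $d$ of objectives is a constant. $\langle\cdot\rangle$ denotes binary encoding length; $\mathcal{O}(\mathsf{poly}(\cdot))$ means bounded by a polynomial in the arguments; sums of sets are Minkowski sums;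 $\mathsf{conv}$ is the convex hull. The cost of each elementary arithmetic operation in the algorithm outside oracle calls (which is bounded polynomially in $\langle I\rangle$) is, for simplicity, counted as $\mathcal{O}(1)$. Plane separating oracle. A plane separating oracle $\mathsf{hpO}$ for $I$ is a black-box algorithm that takes a halfspace $H=\{z\in\mathbb{R}^d:w^{\mathsf T}z\ge c\}$ with $w\in\mathbb{R}^d_{\ge0}$ and returns either $(\textit{inside},\emptyset)$, in which case $f(x)\in H$ for all $x\in X$, or $(\textit{not inside},x)$ where $x\in X$, $\langle x\rangle\in\mathcal{O}(\mathsf{poly}(\langle I\rangle))$ and $f(x)\notin H$. Facet-supporting halfspaces. For a polyhedron $\mathcal{P}$, $\mathcal{H}(\mathcal{P})$ is the set of halfspaces that contain $\mathcal{P}$ and whose boundary contains a facet of $\mathcal{P}$. Inner approximation algorithm. Initialize $R=\{x^{\mathrm{init}}\}$, $k=1$, $F=\emptyset$, $\mathcal{A}^{(1)}=\{f(x^{\mathrm{init}})\}+\mathbb{R}^d_{\ge0}$. While $\mathcal{H}(\mathcal{A}^{(k)})\setminus F\ne\emptyset$: pick an arbitrary halfspace $H=\{z\in\mathbb{R}^d:w^{\mathsf T}z\ge c\}\in\mathcal{H}(\mathcal{A}^{(k)})\setminus F$; set $H_{1+\varepsilon}=\{z\in\mathbb{R}^d:(1+\varepsilon)w^{\mathsf T}z\ge c\}$; call $\mathsf{hpO}(H_{1+\varepsilon})$. If it returns $(\textit{not inside},x^* )$, set $R\gets R\cup\{x^*\}$, $k\gets k+1$, $\mathcal{A}^{(k)}\gets\mathsf{conv}\{f(x):x\in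 R\}+\mathbb{R}^d_{\ge0}$; otherwise set $F\gets F\cup\{H\}$. The facets of $\mathcal{A}^{(k)}$ are computed by a facet enumeration algorithm. *)

theory Defs
  imports
    "HOL-Analysis.Analysis"
    "HOL-Computational_Algebra.Polynomial"
    "HOL-Library.Log_Nat"
    "HOL-Library.Set_Algebras"
begin

section \<open>Encoding lengths and polynomial bounds\<close>

text \<open>One bit for the sign, and the binary digits of \<open>\<bar>z\<bar>\<close>.\<close>

definition int_length :: "int \<Rightarrow> nat" where
  "int_length z = 1 + floorlog 2 (nat \<bar>z\<bar>)"

definition rat_length :: "rat \<Rightarrow> nat" where
  "rat_length r = int_length (fst (quotient_of r)) + int_length (snd (quotient_of r))"

text \<open>The polynomial in three variables with coefficients \<open>C i j k\<close>, all of whose exponents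
  are at most \<open>N\<close>.\<close>

definition poly3 :: "(nat \<Rightarrow> nat \<Rightarrow> nat \<Rightarrow> real) \<Rightarrow> nat \<Rightarrow> real \<Rightarrow> real \<Rightarrow> real \<Rightarrow> real" where
  "poly3 C N x y z = (\<Sum>i\<le>N. \<Sum>j\<le>N. \<Sum>k\<le>N. C i j k * x ^ i * y ^ j * z ^ k)"


section \<open>Multi-objective mixed-integer linear programs\<close>

text \<open>The number \<open>d\<close> of objectives is a constant, so it is the cardinality of the finite index type
  \<open>'d\<close>. The numbers of variables and of constraints vary with the instance; matrices and vectors
  of these sizes are functions on \<open>nat\<close>, of which only the entries below the dimension count.
  The first \<open>n_real\<close> variables are continuous, the next \<open>n_int\<close> ones are integer.\<close>

record 'd momilp =
  n_real :: nat
  n_int :: nat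
  n_cons :: nat
  obj :: "'d \<Rightarrow> nat \<Rightarrow> rat"
  cmat :: "nat \<Rightarrow> nat \<Rightarrow> rat"
  rhs :: "nat \<Rightarrow> rat"

definition n_vars :: "'d momilp \<Rightarrow> nat" where
  "n_vars I = n_real I + n_int I"

text \<open>Entries beyond the dimension are required to be 0, so that every solution is
  represented by exactly one function.\<close>

definition feasible :: "'d momilp \<Rightarrow> (nat \<Rightarrow> real) set" where
  "feasible I = {x.
     (\<forall>i<n_cons I. (\<Sum>j<n_vars I. of_rat (cmat I i j) * x j) \<ge> of_rat (rhs I i)) \<and>
     (\<forall>j. n_real I \<le> j \<and> j < n_vars I \<longrightarrow> x j \<in> \<int>) \<and>
     (\<forall>j\<ge>n_vars I. x j = 0)}"

definition objective :: "'d::finite momilp \<Rightarrow> (nat \<Rightarrow> real) \<Rightarrow> real ^ 'd" where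
  "objective I x = (\<chi> i. \<Sum>j<n_vars I. of_rat (obj I i j) * x j)"

definition images :: "'d::finite momilp \<Rightarrow> (real ^ 'd) set" where
  "images I = objective I ` feasible I"

definition orthant :: "(real ^ 'd::finite) set" where
  "orthant = {z. \<forall>i. 0 \<le> z $ i}"

definition is_momilp :: "'d::finite momilp \<Rightarrow> bool" where
  "is_momilp I \<longleftrightarrow> 0 < n_vars I \<and> 0 < n_cons I \<and> feasible I \<noteq> {} \<and> images I \<subseteq> orthant"

text \<open>Solutions handled by algorithms are rational vectors; only these have an encoding length.\<close>

type_synonym solution = "nat \<Rightarrow> rat"

abbreviation real_sol :: "solution \<Rightarrow> nat \<Rightarrow> real" where
  "real_sol x \<equiv> (\<lambda>j. of_rat (x j))"

definition sol_length :: "'d momilp \<Rightarrow> solution \<Rightarrow> nat" where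
  "sol_length I x = (\<Sum>j<n_vars I. rat_length (x j))"

text \<open>The encoding length of \<open>Q\<close>. The matrix \<open>A\<close> and the vector \<open>b\<close> need no encoding length: an
  instance may describe its constraints implicitly, so they may be exponentially large.\<close>

definition obj_length :: "'d::finite momilp \<Rightarrow> nat" where
  "obj_length I = (\<Sum>i\<in>UNIV. \<Sum>j<n_vars I. rat_length (obj I i j))"


section \<open>Halfspaces, plane separating oracles and facet enumeration\<close>

definition halfspace :: "real ^ 'd::finite \<Rightarrow> real \<Rightarrow> (real ^ 'd) set" where
  "halfspace w c = {z. w \<bullet> z \<ge> c}"

definition facet_halfspaces :: "(real ^ 'd::finite) set \<Rightarrow> (real ^ 'd) set set" where
  "facet_halfspaces P = {H. (\<exists>w c. w \<noteq> 0 \<and> H = halfspace w c) \<and> P \<subseteq> H \<and>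
     (\<exists>G. G facet_of P \<and> G \<subseteq> frontier H)}"

text \<open>The outcome of an algorithm, together with the number of steps it takes.\<close>

datatype 'a timed = Timed (result: 'a) (steps: nat)

datatype answer = Inside | Not_Inside solution

type_synonym 'd hp_oracle = "real ^ 'd \<Rightarrow> real \<Rightarrow> answer timed"

text \<open>\<open>B\<close> bounds the encoding length of the solutions that the oracle returns.\<close>

definition plane_separating_oracle :: "'d::finite momilp \<Rightarrow> real \<Rightarrow> 'd hp_oracle \<Rightarrow> bool" where
  "plane_separating_oracle I B hpO \<longleftrightarrow> (\<forall>w c. w \<in> orthant \<and> w \<noteq> 0 \<longrightarrow>
     (case result (hpO w c) of
        Inside \<Rightarrow> \<forall>x\<in>feasible I. objective I x \<in> halfspace w c
      | Not_Inside x \<Rightarrow> real_sol x \<in> feasible I \<and> real (sol_length I x) \<le> B \<and>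
          objective I (real_sol x) \<notin> halfspace w c))"

definition oracle_time_le :: "'d::finite hp_oracle \<Rightarrow> nat \<Rightarrow> bool" where
  "oracle_time_le hpO T \<longleftrightarrow> (\<forall>w c. w \<in> orthant \<and> w \<noteq> 0 \<longrightarrow> steps (hpO w c) \<le> T)"

definition inner_approx :: "(real ^ 'd::finite) set \<Rightarrow> (real ^ 'd) set" where
  "inner_approx S = convex hull S + orthant"

text \<open>A facet enumeration algorithm lists, without repetition, the facet-supporting halfspaces of
  the inner approximation spanned by the given points.\<close>

type_synonym 'd facet_enum = "(real ^ 'd) list \<Rightarrow> ((real ^ 'd) \<times> real) list timed"

definition facet_enumeration :: "'d::finite facet_enum \<Rightarrow> bool" where
  "facet_enumeration fe \<longleftrightarrow> (\<forall>ys. ys \<noteq> [] \<longrightarrow>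
     (let Hs = map (\<lambda>(w, c). halfspace w c) (result (fe ys))
      in distinct Hs \<and> set Hs = facet_halfspaces (inner_approx (set ys))))"

text \<open>In constant dimension, facet enumeration takes a number of arithmetic operations that is
  polynomial in the number of points.\<close>

definition polynomial_time_enum :: "'d::finite facet_enum \<Rightarrow> bool" where
  "polynomial_time_enum fe \<longleftrightarrow>
     (\<exists>q :: real poly. \<forall>ys. ys \<noteq> [] \<longrightarrow> real (steps (fe ys)) \<le> poly q (real (length ys)))"


section \<open>The inner approximation algorithm\<close>

text \<open>\<open>Loop R Hs F t\<close> is the state at the head of the while loop: \<open>R\<close> lists the solutions found so
  far, \<open>Hs\<close> the facet-supporting halfspaces of the current inner approximation, \<open>F\<close> the halfspaces
  that are finished, and \<open>t\<close> is the time spent. Every arithmetic operation or comparison takes one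
  unit of time.\<close>

datatype 'd state =
    Loop "solution list" "((real ^ 'd) \<times> real) list" "((real ^ 'd) \<times> real) list" nat
  | Halt "solution list" nat

fun elapsed :: "'d::finite state \<Rightarrow> nat" where
  "elapsed (Loop R Hs F t) = t"
| "elapsed (Halt R t) = t"

abbreviation points :: "'d::finite momilp \<Rightarrow> solution list \<Rightarrow> (real ^ 'd) list" where
  "points I R \<equiv> map (\<lambda>x. objective I (real_sol x)) R"

definition open_halfspaces ::
    "((real ^ 'd::finite) \<times> real) list \<Rightarrow> ((real ^ 'd) \<times> real) list \<Rightarrow> ((real ^ 'd) \<times> real) set" where
  "open_halfspaces Hs F =
     {(w, c) \<in> set Hs. halfspace w c \<notin> (\<lambda>(w, c). halfspace w c) ` set F}"

text \<open>Computing \<open>Q x\<close> takes at most \<open>2 d n\<close> operations.\<close>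

definition eval_cost :: "'d::finite momilp \<Rightarrow> nat" where
  "eval_cost I = 2 * CARD('d) * n_vars I"

text \<open>For nonnegative nonzero \<open>w\<close> and \<open>w'\<close> with entry sums \<open>s\<close> and \<open>s'\<close>, the pairs \<open>(w, c)\<close> and
  \<open>(w', c')\<close> represent the same halfspace iff \<open>s' w = s w'\<close> and \<open>s' c = s c'\<close>. This takes at most
  \<open>5 (d + 1)\<close> operations, for each element of \<open>Hs\<close> and each element of \<open>F\<close>.\<close>

definition select_cost ::
    "((real ^ 'd::finite) \<times> real) list \<Rightarrow> ((real ^ 'd) \<times> real) list \<Rightarrow> nat" where
  "select_cost Hs F = 1 + 5 * (CARD('d) + 1) * length Hs * length F"

text \<open>\<open>1 + \<epsilon>\<close> and the scaling of \<open>w\<close> by it.\<close>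

definition relax_cost :: "real ^ 'd::finite \<Rightarrow> nat" where
  "relax_cost w = 1 + CARD('d)"

text \<open>The choice of the halfspace is nondeterministic.\<close>

inductive ia_step ::
    "'d::finite momilp \<Rightarrow> real \<Rightarrow> 'd hp_oracle \<Rightarrow> 'd facet_enum \<Rightarrow> 'd state \<Rightarrow> 'd state \<Rightarrow> bool"
  for I \<epsilon> hpO fe where
  halt:
    "open_halfspaces Hs F = {} \<Longrightarrow>
     ia_step I \<epsilon> hpO fe (Loop R Hs F t) (Halt R (t + select_cost Hs F))"
| inside:
    "(w, c) \<in> open_halfspaces Hs F \<Longrightarrow>
     hpO ((1 + \<epsilon>) *\<^sub>R w) c = Timed Inside u \<Longrightarrow>
     ia_step I \<epsilon> hpO fe (Loop R Hs F t)
       (Loop R Hs ((w, c) # F) (t + select_cost Hs F + relax_cost w + u))"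
| not_inside:
    "(w, c) \<in> open_halfspaces Hs F \<Longrightarrow>
     hpO ((1 + \<epsilon>) *\<^sub>R w) c = Timed (Not_Inside x) u \<Longrightarrow>
     fe (points I (x # R)) = Timed Hs' v \<Longrightarrow>
     ia_step I \<epsilon> hpO fe (Loop R Hs F t)
       (Loop (x # R) Hs' F (t + select_cost Hs F + relax_cost w + u + eval_cost I + v))"

definition ia_init :: "'d::finite momilp \<Rightarrow> 'd facet_enum \<Rightarrow> solution \<Rightarrow> 'd state" where
  "ia_init I fe x =
     Loop [x] (result (fe (points I [x]))) [] (eval_cost I + steps (fe (points I [x])))"

text \<open>Whatever choices are made, the algorithm terminates and never spends more than time \<open>B\<close>.\<close>

definition ia_running_time_le ::
    "'d::finite momilp \<Rightarrow> solution \<Rightarrow> real \<Rightarrow> 'd hp_oracle \<Rightarrow> 'd facet_enum \<Rightarrow> real \<Rightarrow> bool" where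
  "ia_running_time_le I x \<epsilon> hpO fe B \<longleftrightarrow>
     (\<nexists>\<sigma>. \<sigma> 0 = ia_init I fe x \<and> (\<forall>k. ia_step I \<epsilon> hpO fe (\<sigma> k) (\<sigma> (Suc k)))) \<and>
     (\<forall>s. (ia_step I \<epsilon> hpO fe)\<^sup>*\<^sup>* (ia_init I fe x) s \<longrightarrow> real (elapsed s) \<le> B)"


section \<open>Polynomial-time facet enumeration exists\<close>

text \<open>Brute force shows that the assumptions \<open>facet_enumeration\<close> and \<open>polynomial_time_enum\<close> can be
  met by a genuine algorithm. In homogeneous coordinates \<open>(w, c)\<close>, the halfspace is tight at a
  point \<open>y\<close> iff \<open>(w, c)\<close> is orthogonal to \<open>(y, -1)\<close>, and its boundary is parallel to the \<open>i\<close>-th axis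
  iff \<open>(w, c)\<close> is orthogonal to \<open>(axis i 1, 0)\<close>. Every facet is determined by \<open>d\<close> such equations
  together with the normalization \<open>(\<Sum>i\<in>UNIV. w $ i) = 1\<close>.\<close>

definition axes :: "'d::finite list" where
  "axes = (SOME xs. distinct xs \<and> set xs = UNIV)"

definition generators :: "(real ^ 'd::finite) list \<Rightarrow> ((real ^ 'd) \<times> real) list" where
  "generators ys = map (\<lambda>y. (y, -1)) ys @ map (\<lambda>i. (axis i 1, 0)) axes"

definition solves :: "(real ^ 'd::finite) \<times> real \<Rightarrow> ((real ^ 'd) \<times> real) list \<Rightarrow> bool" where
  "solves h gs \<longleftrightarrow> (\<Sum>i\<in>UNIV. fst h $ i) = 1 \<and> (\<forall>g\<in>set gs. h \<bullet> g = 0)"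

definition candidate :: "((real ^ 'd::finite) \<times> real) list \<Rightarrow> ((real ^ 'd) \<times> real) list" where
  "candidate gs = (if \<exists>!h. solves h gs then [THE h. solves h gs] else [])"

definition supports :: "(real ^ 'd::finite) list \<Rightarrow> (real ^ 'd) \<times> real \<Rightarrow> bool" where
  "supports ys h \<longleftrightarrow> (\<forall>g\<in>set (generators ys). h \<bullet> g \<ge> 0)"

text \<open>There are \<open>M = (length ys + d) ^ d\<close> systems. Each has \<open>d + 1\<close> equations and unknowns, and is
  solved by Gaussian elimination in at most \<open>8 (d + 1)\<^sup>3\<close> operations. Checking the solution takes
  \<open>2 (d + 1)\<close> operations per generator, and removing repetitions takes \<open>d + 1\<close> comparisons for
  each pair of solutions.\<close>

definition brute_force :: "'d::finite facet_enum" where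
  "brute_force ys =
    (let d = CARD('d); M = (length ys + d) ^ d in
     Timed
       (remdups (filter (supports ys) (concat (map candidate (List.n_lists d (generators ys))))))
       (M * (8 * (d + 1) ^ 3 + 2 * (d + 1) * (length ys + d)) + M ^ 2 * (d + 1)))"

lemma polynomial_time_brute_force:
  "polynomial_time_enum (brute_force :: 'd::finite facet_enum)"
proof -
  define d where "d = CARD('d)"
  define M :: "real poly" where "M = [:real d, 1:] ^ d"
  define q :: "real poly" where
    "q = M * ([:8 * (real d + 1) ^ 3:] + smult (2 * (real d + 1)) [:real d, 1:]) + smult (real d + 1) (M ^ 2)"
  have "real (steps (brute_force ys)) \<le> poly q (real (length ys))" for ys :: "(real ^ 'd) list"
    unfolding brute_force_def q_def M_def Let_def d_def timed.sel
    by (simp only: poly_add poly_mult poly_power poly_smult poly_pCons poly_0 of_nat_add of_nat_mult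
        of_nat_power of_nat_numeral of_nat_1 mult_zero_right mult_1_right add_0_right) (simp add: ac_simps)
  then show ?thesis unfolding polynomial_time_enum_def by blast
qed

lemma axes: "distinct (axes :: 'd::finite list)" "set (axes :: 'd list) = UNIV"
proof -
  have "\<exists>xs :: 'd list. distinct xs \<and> set xs = UNIV"
    using finite_distinct_list[OF finite_class.finite_UNIV] by blast
  then have "distinct (axes :: 'd list) \<and> set (axes :: 'd list) = UNIV"
    unfolding axes_def by (rule someI_ex)
  then show "distinct (axes :: 'd list)" "set (axes :: 'd list) = UNIV" by auto
qed

lemma set_generators:
  "set (generators ys) = (\<lambda>y. (y, -1)) ` set ys \<union> range (\<lambda>i. (axis i 1, 0))"
  by (simp add: generators_def axes)

lemma supports_iff:
  "supports ys (w, c) \<longleftrightarrow> w \<in> orthant \<and> (\<forall>y\<in>set ys. w \<bullet> y \<ge> c)"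
  by (auto simp: supports_def set_generators orthant_def inner_axis ball_Un)

lemma inner_approxE:
  assumes "z \<in> inner_approx (set ys)"
  obtains u p where "\<forall>y\<in>set ys. 0 \<le> u y" "sum u (set ys) = 1" "p \<in> orthant"
    "z = (\<Sum>y\<in>set ys. u y *\<^sub>R y) + p"
  using assms unfolding inner_approx_def convex_hull_finite[OF finite_set] set_plus_def by blast

lemma point_in_inner_approx:
  assumes "y \<in> S" "p \<in> orthant"
  shows "y + p \<in> inner_approx S"
  unfolding inner_approx_def by (intro set_plus_intro hull_inc assms)

lemma orthant_sum: "(\<Sum>i\<in>UNIV. p $ i *\<^sub>R axis i 1) = p" for p :: "real ^ 'd::finite"
  by (simp add: basis_expansion flip: scalar_mult_eq_scaleR)

lemma inner_approx_decomp:
  fixes ys :: "(real ^ 'd::finite) list"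
  assumes "z \<in> inner_approx (set ys)"
  obtains u p where "\<forall>y\<in>set ys. 0 \<le> u y" "\<forall>i. 0 \<le> p $ i"
    "(z, -1 :: real) = (\<Sum>y\<in>set ys. u y *\<^sub>R (y, -1)) + (\<Sum>i\<in>UNIV. p $ i *\<^sub>R (axis i 1, 0))"
proof -
  obtain u p where u: "\<forall>y\<in>set ys. 0 \<le> u y"
    "sum u (set ys) = 1" "p \<in> orthant" "z = (\<Sum>y\<in>set ys. u y *\<^sub>R y) + p"
    by (rule inner_approxE[OF assms])
  have "(\<Sum>y\<in>set ys. u y *\<^sub>R (y, -1 :: real)) = (\<Sum>y\<in>set ys. u y *\<^sub>R y, - sum u (set ys))"
    by (simp add: sum_prod sum_negf)
  moreover have "(\<Sum>i\<in>UNIV. p $ i *\<^sub>R (axis i 1 :: real ^ 'd, 0 :: real)) = (p, 0)"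
    by (simp add: sum_prod orthant_sum)
  ultimately have "(z, -1 :: real) = (\<Sum>y\<in>set ys. u y *\<^sub>R (y, -1)) + (\<Sum>i\<in>UNIV. p $ i *\<^sub>R (axis i 1, 0))"
    using u(2,4) by simp
  moreover have "\<forall>i. 0 \<le> p $ i" using u(3) by (simp add: orthant_def)
  ultimately show ?thesis using that[OF u(1)] by blast
qed

lemma supports_imp:
  assumes "supports ys (w, c)" "z \<in> inner_approx (set ys)"
  shows "w \<bullet> z \<ge> c"
proof -
  obtain u p where u: "\<forall>y\<in>set ys. 0 \<le> u y"
    "\<forall>i. 0 \<le> p $ i"
    and z: "(z, -1 :: real) = (\<Sum>y\<in>set ys. u y *\<^sub>R (y, -1)) + (\<Sum>i\<in>UNIV. p $ i *\<^sub>R (axis i 1, 0))"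
    by (rule inner_approx_decomp[OF assms(2)])
  have "(w, c) \<bullet> (z, -1) = (\<Sum>y\<in>set ys. u y * ((w, c) \<bullet> (y, -1))) + (\<Sum>i\<in>UNIV. p $ i * ((w, c) \<bullet> (axis i 1, 0)))"
    unfolding z by (simp only: inner_add_right inner_sum_right inner_scaleR_right)
  also have "\<dots> \<ge> 0"
    using assms(1) u unfolding supports_def set_generators
    by (intro add_nonneg_nonneg sum_nonneg mult_nonneg_nonneg) blast+
  finally show ?thesis by simp
qed

lemma supports_if:
  fixes ys :: "(real ^ 'd::finite) list"
  assumes "ys \<noteq> []" "inner_approx (set ys) \<subseteq> halfspace w c"
  shows "supports ys (w, c)"
proof -
  have 0: "0 \<in> (orthant :: (real ^ 'd) set)" by (simp add: orthant_def)
  have pt: "w \<bullet> (y + p) \<ge> c" if "y \<in> set ys" "p \<in> orthant" for y p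
    using point_in_inner_approx[OF that] assms(2) by (auto simp: halfspace_def)
  obtain y where y: "y \<in> set ys" using assms(1) by (cases ys) auto
  have "0 \<le> w $ i" for i
  proof (rule ccontr)
    assume n: "\<not> 0 \<le> w $ i"
    define t where "t = (\<bar>w \<bullet> y - c\<bar> + 1) / (- (w $ i))"
    have t: "t > 0" unfolding t_def using n by (intro divide_pos_pos) linarith+
    have "t *\<^sub>R axis i 1 \<in> (orthant :: (real ^ 'd) set)"
      using t by (auto simp: orthant_def axis_def)
    from pt[OF y this] have "c \<le> w \<bullet> y + t * w $ i"
      by (simp add: inner_add_right inner_axis)
    moreover have "t * w $ i = - (\<bar>w \<bullet> y - c\<bar> + 1)" using n by (simp add: t_def field_simps)
    ultimately show False by linarith
  qed
  then show ?thesis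
    using pt[OF _ 0] by (auto simp: supports_iff orthant_def)
qed

lemma tight_in_span:
  assumes sup: "supports ys h" and z: "z \<in> inner_approx (set ys)" "h \<bullet> (z, -1) = 0"
  shows "(z, -1) \<in> span {g \<in> set (generators ys). h \<bullet> g = 0}" (is "_ \<in> span ?B")
proof -
  obtain u p where u: "\<forall>y\<in>set ys. 0 \<le> u y"
    "\<forall>i. 0 \<le> p $ i"
    and eq: "(z, -1 :: real) = (\<Sum>y\<in>set ys. u y *\<^sub>R (y, -1)) + (\<Sum>i\<in>UNIV. p $ i *\<^sub>R (axis i 1, 0))"
    by (rule inner_approx_decomp[OF z(1)])
  let ?a = "\<lambda>y. u y * (h \<bullet> (y, -1))" and ?b = "\<lambda>i. p $ i * (h \<bullet> (axis i 1, 0))"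
  have nn: "0 \<le> ?a y" if "y \<in> set ys" for y
    using sup u that unfolding supports_def set_generators by (intro mult_nonneg_nonneg) blast+
  have nn': "0 \<le> ?b i" for i
    using sup u unfolding supports_def set_generators by (intro mult_nonneg_nonneg) blast+
  have "sum ?a (set ys) + sum ?b UNIV = 0"
    using z(2) unfolding eq by (simp only: inner_add_right inner_sum_right inner_scaleR_right)
  moreover have "0 \<le> sum ?a (set ys)" "0 \<le> sum ?b UNIV" using nn nn' by (auto intro: sum_nonneg)
  ultimately have "sum ?a (set ys) = 0" "sum ?b UNIV = 0" by linarith+
  have "\<forall>y\<in>set ys. ?a y = 0"
    using \<open>sum ?a (set ys) = 0\<close> nn by (subst (asm) sum_nonneg_eq_0_iff) auto
  then have a0: "?a y = 0" if "y \<in> set ys" for y using that by blast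
  have "\<forall>i\<in>UNIV. ?b i = 0"
    using \<open>sum ?b UNIV = 0\<close> nn' by (subst (asm) sum_nonneg_eq_0_iff) auto
  then have b0: "?b i = 0" for i by blast
  have "u y *\<^sub>R (y, -1) \<in> span ?B" if "y \<in> set ys" for y
  proof (cases "u y = 0")
    case True then show ?thesis by (simp only: scaleR_zero_left span_zero)
  next
    case False
    then have "h \<bullet> (y, -1) = 0" using a0[OF that] by (simp only: mult_eq_0_iff) simp
    then show ?thesis using that unfolding set_generators by (intro span_scale span_base) blast
  qed
  moreover have "p $ i *\<^sub>R (axis i 1, 0) \<in> span ?B" for i
  proof (cases "p $ i = 0")
    case True then show ?thesis by (simp only: scaleR_zero_left span_zero)
  next
    case False
    then have "h \<bullet> (axis i 1, 0) = 0" using b0[of i] by (simp only: mult_eq_0_iff) simp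
    then show ?thesis unfolding set_generators by (intro span_scale span_base) blast
  qed
  ultimately show ?thesis unfolding eq by (intro span_add span_sum)
qed

lemma hyperplane_unique:
  fixes w w' :: "real ^ 'd::finite"
  assumes w: "(\<Sum>i\<in>UNIV. w $ i) = 1" and w': "(\<Sum>i\<in>UNIV. w' $ i) = 1"
    and sub: "{z. w \<bullet> z = c} \<subseteq> {z. w' \<bullet> z = c'}"
  shows "w' = w \<and> c' = c"
proof -
  have "w \<noteq> 0" using w by auto
  then have ww: "w \<bullet> w \<noteq> 0" by simp
  define z0 where "z0 = (c / (w \<bullet> w)) *\<^sub>R w"
  have z0: "w \<bullet> z0 = c" using ww by (simp add: z0_def)
  then have z0': "w' \<bullet> z0 = c'" using sub by auto
  have orth: "w' \<bullet> v = 0" if "w \<bullet> v = 0" for v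
  proof -
    have "w \<bullet> (z0 + v) = c" using z0 that by (simp add: inner_add_right)
    then have "w' \<bullet> (z0 + v) = c'" using sub by auto
    then show ?thesis using z0' by (simp add: inner_add_right)
  qed
  define l where "l = (w \<bullet> w') / (w \<bullet> w)"
  define v where "v = w' - l *\<^sub>R w"
  have wv: "w \<bullet> v = 0" using ww by (simp add: v_def l_def inner_diff_right)
  have "v \<bullet> v = w' \<bullet> v - l * (w \<bullet> v)" by (simp add: v_def inner_diff_left)
  then have "v = 0" using wv orth[OF wv] by simp
  then have eq: "w' = l *\<^sub>R w" by (simp add: v_def)
  have "(\<Sum>i\<in>UNIV. w' $ i) = l * (\<Sum>i\<in>UNIV. w $ i)" by (simp add: eq sum_distrib_left)
  then have "l = 1" using w w' by simp
  then show ?thesis using eq z0 z0' by simp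
qed

lemma frontier_halfspace: "w \<noteq> 0 \<Longrightarrow> frontier (halfspace w c) = {z. w \<bullet> z = c}"
  unfolding halfspace_def by (rule frontier_halfspace_ge) simp

lemma convex_inner_approx: "convex (inner_approx S)"
proof -
  have "convex (orthant :: (real ^ 'd::finite) set)"
    by (auto simp: convex_def orthant_def)
  then show ?thesis unfolding inner_approx_def by (intro convex_set_plus convex_convex_hull)
qed

lemma aff_dim_inner_approx:
  fixes S :: "(real ^ 'd::finite) set"
  assumes "S \<noteq> {}"
  shows "aff_dim (inner_approx S) = CARD('d)"
proof -
  obtain y where y: "y \<in> S" using assms by auto
  have "box y (y + 1) \<subseteq> inner_approx S"
  proof
    fix z assume "z \<in> box y (y + 1)"
    then have "z - y \<in> orthant" by (auto simp: mem_box_cart orthant_def less_imp_le)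
    from point_in_inner_approx[OF y this] show "z \<in> inner_approx S" by simp
  qed
  then have "box y (y + 1) \<subseteq> interior (inner_approx S)" by (rule interior_maximal) (rule open_box)
  moreover have "y + (1/2) *\<^sub>R 1 \<in> box y (y + 1)" by (simp add: mem_box_cart)
  ultimately have "interior (inner_approx S) \<noteq> {}" by auto
  from aff_dim_nonempty_interior[OF this] show ?thesis by simp
qed

lemma set_candidate: "h \<in> set (candidate gs) \<longleftrightarrow> solves h gs \<and> (\<forall>h'. solves h' gs \<longrightarrow> h' = h)"
proof (cases "\<exists>!h. solves h gs")
  case True
  then show ?thesis using theI'[OF True] unfolding candidate_def by auto
next
  case False
  then show ?thesis unfolding candidate_def by auto
qed

lemma set_brute_force:
  "h \<in> set (result (brute_force ys)) \<longleftrightarrow> supports ys h \<and>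
     (\<exists>gs. length gs = CARD('d) \<and> set gs \<subseteq> set (generators ys) \<and> solves h gs \<and>
        (\<forall>h'. solves h' gs \<longrightarrow> h' = h))"
  for ys :: "(real ^ 'd::finite) list"
  by (auto simp: brute_force_def Let_def set_n_lists set_candidate)

lemma brute_force_sound:
  fixes ys :: "(real ^ 'd::finite) list"
  assumes mem: "(w, c) \<in> set (result (brute_force ys))" and ne: "ys \<noteq> []"
  shows "halfspace w c \<in> facet_halfspaces (inner_approx (set ys))"
proof -
  define A where "A = inner_approx (set ys)"
  define G where "G = A \<inter> {z. w \<bullet> z = c}"
  obtain gs where sup: "supports ys (w, c)" and gs: "set gs \<subseteq> set (generators ys)"
    and sol: "solves (w, c) gs" and uniq: "\<And>h'. solves h' gs \<Longrightarrow> h' = (w, c)"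
    using mem unfolding set_brute_force by blast
  have s1: "(\<Sum>i\<in>UNIV. w $ i) = 1" using sol by (simp add: solves_def)
  then have w0: "w \<noteq> 0" by auto
  have 0: "0 \<in> (orthant :: (real ^ 'd) set)" by (simp add: orthant_def)
  have AH: "w \<bullet> z \<ge> c" if "z \<in> A" for z using supports_imp[OF sup] that by (simp add: A_def)
  have inG: "y \<in> G" if "(y, -1) \<in> set gs" "y \<in> set ys" for y
    using that point_in_inner_approx[OF that(2) 0] sol
    by (auto simp: G_def A_def solves_def)
  have "\<exists>y. y \<in> set ys \<and> (y, -1) \<in> set gs"
  proof (rule ccontr)
    assume "\<not> ?thesis"
    then have "set gs \<subseteq> range (\<lambda>i. (axis i 1, 0))" using gs unfolding set_generators by blast
    then have "solves (w, c + 1) gs" using sol unfolding solves_def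
      by (fastforce simp: inner_axis)
    from uniq[OF this] show False by simp
  qed
  then obtain a where a: "a \<in> set ys" "(a, -1) \<in> set gs" by blast
  have aG: "a \<in> G" using inG a by blast
  have aff: "affine hull G = {z. w \<bullet> z = c}"
  proof
    show "affine hull G \<subseteq> {z. w \<bullet> z = c}"
      by (rule hull_minimal) (auto simp: G_def affine_hyperplane)
    show "{z. w \<bullet> z = c} \<subseteq> affine hull G"
    proof
      fix z assume "z \<in> {z. w \<bullet> z = c}"
      then have z: "w \<bullet> z = c" by simp
      let ?V = "(\<lambda>x. - a + x) ` (G - {a})"
      obtain v u where v: "v \<in> span ?V" and u: "\<And>x. x \<in> span ?V \<Longrightarrow> orthogonal u x"
        and dec: "z - a = v + u" using orthogonal_subspace_decomp_exists[of ?V "z - a"] by metis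
      define h where "h = (u, u \<bullet> a)"
      have uG: "u \<bullet> x = u \<bullet> a" if "x \<in> G" for x
      proof (cases "x = a")
        case False
        then have "- a + x \<in> span ?V" using that by (intro span_base) blast
        from u[OF this] show ?thesis by (simp add: orthogonal_def inner_diff_right)
      qed simp
      have hg: "h \<bullet> g = 0" if "g \<in> set gs" for g
      proof -
        from that gs consider y where "y \<in> set ys" "g = (y, -1)" | i where "g = (axis i 1, 0)"
          unfolding set_generators by blast
        then show ?thesis
        proof cases
          case 1
          then show ?thesis using uG[OF inG[of y]] that by (simp add: h_def)
        next
          case 2
          have wi: "w $ i = 0" using sol that 2 by (auto simp: solves_def inner_axis)
          have "axis i 1 \<in> (orthant :: (real ^ 'd) set)" by (simp add: orthant_def axis_def)
          from point_in_inner_approx[OF a(1) this] have "a + axis i 1 \<in> G"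
            using aG wi by (simp add: G_def A_def inner_add_right inner_axis)
          from uG[OF this] show ?thesis using 2 by (simp add: h_def inner_add_right)
        qed
      qed
      define s where "s = (\<Sum>i\<in>UNIV. u $ i)"
      have "solves ((1 - s) *\<^sub>R (w, c) + h) gs"
        unfolding solves_def
      proof (intro conjI ballI)
        show "(\<Sum>i\<in>UNIV. fst ((1 - s) *\<^sub>R (w, c) + h) $ i) = 1"
          using s1 by (simp add: h_def s_def sum.distrib flip: sum_distrib_left)
        fix g assume "g \<in> set gs"
        then show "((1 - s) *\<^sub>R (w, c) + h) \<bullet> g = 0"
          using sol hg by (simp add: inner_add_left inner_scaleR_left solves_def del: scaleR_Pair)
      qed
      from uniq[OF this] have "h = s *\<^sub>R (w, c)"
        proof -
        assume "(1 - s) *\<^sub>R (w, c) + h = (w, c)"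
        then have "(w, c) - s *\<^sub>R (w, c) + h = (w, c)" by (simp only: scaleR_left_diff_distrib scaleR_one)
        then have "h - s *\<^sub>R (w, c) = 0" by (metis add_diff_eq diff_add_eq add_cancel_left_right)
        then show ?thesis by (simp only: right_minus_eq)
      qed
      then have us: "u = s *\<^sub>R w" by (simp add: h_def)
      have "w \<bullet> (z - a) = 0" using z aG by (simp add: G_def inner_diff_right)
      then have "u \<bullet> (z - a) = 0" by (simp add: us)
      moreover have "u \<bullet> v = 0" using u[OF v] by (simp add: orthogonal_def)
      ultimately have "u \<bullet> u = 0" unfolding dec by (simp add: inner_add_right)
      then have "z = a + v" using dec by (simp add: algebra_simps)
      then show "z \<in> affine hull G" unfolding affine_hull_span2[OF aG] using v by blast
    qed
  qed
  have "aff_dim G = DIM(real ^ 'd) - 1" using aff w0 unfolding aff_dim_eq_hyperplane by blast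
  moreover have "G face_of A" unfolding G_def A_def
    by (rule face_of_Int_supporting_hyperplane_ge[OF convex_inner_approx]) (use AH in \<open>simp add: A_def\<close>)
  moreover have "aff_dim A = CARD('d)" using ne by (simp add: A_def aff_dim_inner_approx)
  ultimately have "G facet_of A" using aG by (auto simp: facet_of_def)
  moreover have "A \<subseteq> halfspace w c" using AH by (auto simp: halfspace_def)
  moreover have "G \<subseteq> frontier (halfspace w c)" using w0 by (auto simp: frontier_halfspace G_def)
  ultimately show ?thesis unfolding facet_halfspaces_def A_def using w0 by blast
qed

lemma brute_force_complete:
  fixes ys :: "(real ^ 'd::finite) list"
  assumes H: "H \<in> facet_halfspaces (inner_approx (set ys))" and ne: "ys \<noteq> []"
  shows "\<exists>w c. (w, c) \<in> set (result (brute_force ys)) \<and> H = halfspace w c"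
proof -
  define A where "A = inner_approx (set ys)"
  obtain w0 c0 G where w00: "w0 \<noteq> 0" and H0: "H = halfspace w0 c0" and AH0: "A \<subseteq> H"
    and G: "G facet_of A" "G \<subseteq> frontier H"
    using H unfolding facet_halfspaces_def A_def by blast
  have sup0: "supports ys (w0, c0)" using supports_if[OF ne] AH0 H0 A_def by blast
  then have nn: "\<And>i. 0 \<le> w0 $ i" by (simp add: supports_iff orthant_def)
  define s where "s = (\<Sum>i\<in>UNIV. w0 $ i)"
  have "s \<noteq> 0"
  proof
    assume "s = 0"
    then have "\<forall>i\<in>UNIV. w0 $ i = 0" unfolding s_def using nn by (subst (asm) sum_nonneg_eq_0_iff) auto
    then show False using w00 by (simp add: vec_eq_iff)
  qed
  moreover have "0 \<le> s" unfolding s_def by (intro sum_nonneg) (rule nn)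
  ultimately have s: "0 < s" by simp
  define w c where "w = (1 / s) *\<^sub>R w0" and "c = c0 / s"
  have s1: "(\<Sum>i\<in>UNIV. w $ i) = 1" using s by (simp add: w_def s_def flip: sum_divide_distrib)
  then have w0: "w \<noteq> 0" by auto
  have Hwc: "H = halfspace w c"
    unfolding H0 halfspace_def w_def c_def using s by (simp add: divide_le_cancel)
  have sup: "supports ys (w, c)" using supports_if[OF ne] AH0 Hwc A_def by blast
  have Gw: "w \<bullet> z = c" if "z \<in> G" for z using G(2) that w0 by (auto simp: Hwc frontier_halfspace)
  have GA: "G \<subseteq> A" using G(1) by (simp add: facet_of_imp_subset)
  have Gne: "G \<noteq> {}" using G(1) by (simp add: facet_of_def)
  have dimG: "aff_dim G = CARD('d) - 1"
    using G(1) ne by (simp add: facet_of_def A_def aff_dim_inner_approx)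
  have affG: "affine hull G = {z. w \<bullet> z = c}"
  proof (rule affine_dim_equal)
    show "affine hull G \<subseteq> {z. w \<bullet> z = c}"
      by (rule hull_minimal) (use Gw in \<open>auto simp: affine_hyperplane\<close>)
    show "aff_dim (affine hull G) = aff_dim {z. w \<bullet> z = c}" using dimG w0 by simp
  qed (use Gne in \<open>auto simp: affine_hyperplane affine_affine_hull\<close>)
  define B where "B = {g \<in> set (generators ys). (w, c) \<bullet> g = 0}"
  have Gspan: "(z, -1) \<in> span B" if "z \<in> G" for z
    unfolding B_def using tight_in_span[OF sup] GA that Gw[OF that] A_def by auto
  obtain B' where B': "B' \<subseteq> B" "independent B'" "B \<subseteq> span B'" "card B' = dim B"
    using basis_exists by blast
  have fin: "finite B'" using B'(1) by (rule finite_subset) (simp add: B_def)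
  have spB: "span B' = span B" using B' by (metis span_eq subset_trans span_superset)
  have "dim B \<le> dim {x. (w, c) \<bullet> x = 0}" by (rule dim_subset) (auto simp: B_def)
  also have "\<dots> = CARD('d)" using w0 by (subst dim_hyperplane) (auto simp: zero_prod_def)
  finally have card: "card B' \<le> CARD('d)" using B'(4) by simp
  have "B' \<noteq> {}"
  proof
    assume "B' = {}"
    then have "span B = {0}" using spB by simp
    then show False using Gspan Gne by (auto simp: zero_prod_def)
  qed
  then obtain b where b: "b \<in> B'" by auto
  obtain bs where bs: "set bs = B'" "distinct bs" using finite_distinct_list[OF fin] by blast
  define gs where "gs = bs @ replicate (CARD('d) - length bs) b"
  have set_gs: "set gs = B'" using bs b by (auto simp: gs_def)
  have "length bs = card B'" using bs by (metis distinct_card)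
  then have len: "length gs = CARD('d)" using card by (simp add: gs_def)
  have sol: "solves (w, c) gs" using s1 B'(1) by (auto simp: solves_def set_gs B_def)
  have uniq: "h' = (w, c)" if "solves h' gs" for h'
  proof -
    obtain w' c' where h': "h' = (w', c')" by (cases h')
    have s1': "(\<Sum>i\<in>UNIV. w' $ i) = 1" using that by (simp add: solves_def h')
    have "(w', c') \<bullet> x = 0" if x: "x \<in> span B'" for x
      using x
    proof (induction rule: span_induct)
      show "subspace {x. (w', c') \<bullet> x = 0}" by (rule subspace_hyperplane)
    qed (use \<open>solves h' gs\<close> in \<open>auto simp: solves_def h' set_gs\<close>)
    then have "w' \<bullet> z = c'" if "z \<in> G" for z using Gspan[OF that] by (fastforce simp: spB)
    then have "affine hull G \<subseteq> {z. w' \<bullet> z = c'}"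
      by (intro hull_minimal) (auto simp: affine_hyperplane)
    from hyperplane_unique[OF s1 s1' this[unfolded affG]] show ?thesis by (simp add: h')
  qed
  have "set gs \<subseteq> set (generators ys)" using B'(1) by (auto simp: set_gs B_def)
  then have "(w, c) \<in> set (result (brute_force ys))"
    unfolding set_brute_force using sup len sol uniq by blast
  then show ?thesis using Hwc by blast
qed

theorem facet_enumeration_brute_force: "facet_enumeration brute_force"
  unfolding facet_enumeration_def Let_def
proof (intro allI impI conjI)
  fix ys :: "(real ^ 'd::finite) list" assume ne: "ys \<noteq> []"
  let ?R = "result (brute_force ys)"
  have "inj_on (\<lambda>(w, c). halfspace w c) (set ?R)"
  proof (rule inj_onI, clarify)
    fix w c w' c'
    assume R: "(w, c) \<in> set ?R" "(w', c') \<in> set ?R" and eq: "halfspace w c = halfspace w' c'"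
    have s1: "(\<Sum>i\<in>UNIV. w $ i) = 1" "(\<Sum>i\<in>UNIV. w' $ i) = 1"
      using R by (auto simp: set_brute_force solves_def)
    then have "w \<noteq> 0" "w' \<noteq> 0" by auto
    have "{z. w \<bullet> z = c} = {z. w' \<bullet> z = c'}"
      using arg_cong[OF eq, of frontier]
      unfolding frontier_halfspace[OF \<open>w \<noteq> 0\<close>] frontier_halfspace[OF \<open>w' \<noteq> 0\<close>] .
    from hyperplane_unique[OF s1 equalityD1[OF this]] show "w = w' \<and> c = c'" by simp
  qed
  moreover have "distinct ?R" by (simp add: brute_force_def Let_def)
  ultimately show "distinct (map (\<lambda>(w, c). halfspace w c) ?R)" by (simp add: distinct_map)
  show "set (map (\<lambda>(w, c). halfspace w c) ?R) = facet_halfspaces (inner_approx (set ys))"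
    using brute_force_sound[OF _ ne] brute_force_complete[OF _ ne] by (auto simp: image_iff) blast+
qed

end

theory Submission
  imports Defs
begin

text \<open>Each time the oracle returns a new solution, it refutes the relaxation of a facet of the
  current inner approximation: there are \<open>w \<ge> 0\<close> and \<open>c\<close> with \<open>w \<bullet> y \<ge> c\<close> for the images \<open>y\<close> of all
  earlier solutions, but \<open>(1 + \<epsilon>) (w \<bullet> y') < c\<close> for the new image \<open>y'\<close>. Hence no earlier image satisfies
  \<open>y \<le> (1 + \<epsilon>) y'\<close> coordinatewise. Divide each axis at the powers of \<open>1 + \<epsilon>\<close>, with an
  extra class for 0. Points of the same cell differ by at most the factor \<open>1 + \<epsilon>\<close> in each coordinate,
  so the images of the solutions found lie in distinct cells (\<open>separated_Cons\<close>).

  The number of cells that can be hit is polynomial: a positive coordinate of an image is a sum of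
  products of rationals with short encodings, hence a rational whose logarithm is at most the total
  encoding length \<open>L\<close> in absolute value (\<open>scalar_product_magnitude\<close>). Since
  \<open>1 / ln (1 + \<epsilon>) \<le> 1 + 1 / \<epsilon>\<close>, each coordinate takes \<open>O (L (1 + 1 / \<epsilon>))\<close> indices, and the
  dimension is constant (\<open>card_le_num_cells\<close>).

  An iteration without a new solution finishes a halfspace. Between two new solutions there
  are at most as many of these as the current approximation has facets, and their number is
  polynomial in the number of points because the dimension is constant (\<open>facet_enumeration_length\<close>).
  So the number of iterations is polynomial, and with it the lengths of all lists and the time
  of each iteration. It remains to see that the explicit bound grows polynomially in all
  arguments, which follows from its construction by sums, products and polynomials
  (\<open>poly_bounded_run_bound\<close>).\<close>


section \<open>Polynomially bounded functions\<close>

text \<open>A criterion for polynomial growth that is closed under sums, products and composition with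
  polynomials without any bookkeeping of coefficients. The product \<open>(1 + x) * (1 + y) * (1 + z)\<close> is
  at least 1 and dominates each argument, so constants and exponents can simply be added up.\<close>

definition poly_bounded :: "(real \<Rightarrow> real \<Rightarrow> real \<Rightarrow> real) \<Rightarrow> bool" where
  "poly_bounded f \<longleftrightarrow> (\<exists>c k. \<forall>x\<ge>0. \<forall>y\<ge>0. \<forall>z\<ge>0.
     \<bar>f x y z\<bar> \<le> c * ((1 + x) * (1 + y) * (1 + z)) ^ k)"

lemma poly_boundedI:
  assumes "\<And>x y z. 0 \<le> x \<Longrightarrow> 0 \<le> y \<Longrightarrow> 0 \<le> z \<Longrightarrow>
    \<bar>f x y z\<bar> \<le> c * ((1 + x) * (1 + y) * (1 + z)) ^ k"
  shows "poly_bounded f"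
  using assms unfolding poly_bounded_def by blast

lemma one_le_prod3: "1 \<le> (1 + x) * (1 + y) * (1 + z)"
  if "0 \<le> x" "0 \<le> y" "0 \<le> z" for x y z :: real
proof -
  have "1 * 1 * 1 \<le> (1 + x) * (1 + y) * (1 + z)" using that by (intro mult_mono) auto
  then show ?thesis by simp
qed

lemma poly_bounded_const: "poly_bounded (\<lambda>x y z. a)"
  by (rule poly_boundedI[where c = "\<bar>a\<bar>" and k = 0]) simp

lemma poly_bounded_proj:
  "poly_bounded (\<lambda>x y z. x)" "poly_bounded (\<lambda>x y z. y)" "poly_bounded (\<lambda>x y z. z)"
proof -
  have "x + y + z \<le> (1 + x) * (1 + y) * (1 + z)" if "0 \<le> x" "0 \<le> y" "0 \<le> z" for x y z :: real
    using that by (simp add: algebra_simps)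
  then have "x \<le> (1 + x) * (1 + y) * (1 + z) \<and> y \<le> (1 + x) * (1 + y) * (1 + z) \<and>
      z \<le> (1 + x) * (1 + y) * (1 + z)" if "0 \<le> x" "0 \<le> y" "0 \<le> z" for x y z :: real
    using that by (smt (verit))
  then show "poly_bounded (\<lambda>x y z. x)" "poly_bounded (\<lambda>x y z. y)" "poly_bounded (\<lambda>x y z. z)"
    by (auto intro!: poly_boundedI[where c = 1 and k = 1])
qed

lemma poly_bounded_add:
  assumes "poly_bounded f" "poly_bounded g"
  shows "poly_bounded (\<lambda>x y z. f x y z + g x y z)"
proof -
  obtain c k where f: "\<And>x y z. 0 \<le> x \<Longrightarrow> 0 \<le> y \<Longrightarrow> 0 \<le> z \<Longrightarrow>
      \<bar>f x y z\<bar> \<le> c * ((1 + x) * (1 + y) * (1 + z)) ^ k"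
    using assms(1) unfolding poly_bounded_def by blast
  obtain c' k' where g: "\<And>x y z. 0 \<le> x \<Longrightarrow> 0 \<le> y \<Longrightarrow> 0 \<le> z \<Longrightarrow>
      \<bar>g x y z\<bar> \<le> c' * ((1 + x) * (1 + y) * (1 + z)) ^ k'"
    using assms(2) unfolding poly_bounded_def by blast
  have c0: "0 \<le> c" "0 \<le> c'" using f[of 0 0 0] g[of 0 0 0] by auto
  show ?thesis
  proof (rule poly_boundedI[where c = "c + c'" and k = "k + k'"])
    fix x y z :: real assume xyz: "0 \<le> x" "0 \<le> y" "0 \<le> z"
    define P where "P = (1 + x) * (1 + y) * (1 + z)"
    have P: "1 \<le> P" unfolding P_def by (rule one_le_prod3[OF xyz])
    have "\<bar>f x y z + g x y z\<bar> \<le> c * P ^ k + c' * P ^ k'"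
      using f[OF xyz] g[OF xyz] unfolding P_def by linarith
    also have "\<dots> \<le> c * P ^ (k + k') + c' * P ^ (k + k')"
      using P c0 by (intro add_mono mult_left_mono power_increasing) auto
    finally show "\<bar>f x y z + g x y z\<bar> \<le> (c + c') * ((1 + x) * (1 + y) * (1 + z)) ^ (k + k')"
      by (simp add: P_def distrib_right)
  qed
qed

lemma poly_bounded_mult:
  assumes "poly_bounded f" "poly_bounded g"
  shows "poly_bounded (\<lambda>x y z. f x y z * g x y z)"
proof -
  obtain c k where f: "\<And>x y z. 0 \<le> x \<Longrightarrow> 0 \<le> y \<Longrightarrow> 0 \<le> z \<Longrightarrow>
      \<bar>f x y z\<bar> \<le> c * ((1 + x) * (1 + y) * (1 + z)) ^ k"
    using assms(1) unfolding poly_bounded_def by blast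
  obtain c' k' where g: "\<And>x y z. 0 \<le> x \<Longrightarrow> 0 \<le> y \<Longrightarrow> 0 \<le> z \<Longrightarrow>
      \<bar>g x y z\<bar> \<le> c' * ((1 + x) * (1 + y) * (1 + z)) ^ k'"
    using assms(2) unfolding poly_bounded_def by blast
  show ?thesis
  proof (rule poly_boundedI[where c = "c * c'" and k = "k + k'"])
    fix x y z :: real assume xyz: "0 \<le> x" "0 \<le> y" "0 \<le> z"
    have "\<bar>f x y z * g x y z\<bar> \<le> (c * ((1 + x) * (1 + y) * (1 + z)) ^ k) *
        (c' * ((1 + x) * (1 + y) * (1 + z)) ^ k')"
      unfolding abs_mult by (intro mult_mono f g xyz order_trans[OF _ f[OF xyz]]) auto
    then show "\<bar>f x y z * g x y z\<bar> \<le> c * c' * ((1 + x) * (1 + y) * (1 + z)) ^ (k + k')"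
      by (simp add: power_add mult_ac)
  qed
qed

lemma poly_bounded_power:
  assumes "poly_bounded f"
  shows "poly_bounded (\<lambda>x y z. f x y z ^ n)"
  by (induction n) (simp_all add: poly_bounded_const poly_bounded_mult assms)

lemma poly_bounded_poly:
  assumes "poly_bounded f"
  shows "poly_bounded (\<lambda>x y z. poly p (f x y z))"
proof (induction p)
  case 0
  show ?case by (simp add: poly_bounded_const)
next
  case (pCons a p)
  then show ?case by (simp add: poly_bounded_add poly_bounded_const poly_bounded_mult assms)
qed

lemmas poly_bounded_intros =
  poly_bounded_const poly_bounded_proj poly_bounded_add poly_bounded_mult poly_bounded_power
  poly_bounded_poly

text \<open>The three binomial expansions multiply out to one sum over exponents, so the dominating
  function of \<open>poly_bounded\<close> is itself of the form \<open>poly3\<close>.\<close>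

lemma poly3_binomial:
  "poly3 (\<lambda>i j l. c * real (k choose i) * real (k choose j) * real (k choose l)) k x y z =
     c * ((1 + x) * (1 + y) * (1 + z)) ^ k"
proof -
  have b: "(1 + t) ^ k = (\<Sum>i\<le>k. real (k choose i) * t ^ i)" for t :: real
    using binomial_ring[of t 1 k] by (simp add: add.commute)
  show ?thesis
    unfolding poly3_def power_mult_distrib b
    by (subst sum.swap) (simp add: sum_distrib_left sum_distrib_right mult_ac)
qed

lemma poly_bounded_imp_poly3:
  assumes "poly_bounded f"
  shows "\<exists>C N. \<forall>x\<ge>0. \<forall>y\<ge>0. \<forall>z\<ge>0. f x y z \<le> poly3 C N x y z"
proof -
  obtain c k where f: "\<And>x y z. 0 \<le> x \<Longrightarrow> 0 \<le> y \<Longrightarrow> 0 \<le> z \<Longrightarrow>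
      \<bar>f x y z\<bar> \<le> c * ((1 + x) * (1 + y) * (1 + z)) ^ k"
    using assms unfolding poly_bounded_def by blast
  show ?thesis
  proof (intro exI allI impI)
    fix x y z :: real assume "0 \<le> x" "0 \<le> y" "0 \<le> z"
    from f[OF this] show "f x y z \<le>
      poly3 (\<lambda>i j l. c * real (k choose i) * real (k choose j) * real (k choose l)) k x y z"
      unfolding poly3_binomial by linarith
  qed
qed

text \<open>A polynomial need not be monotone, but replacing its coefficients by their absolute values
  makes it so on the nonnegative reals. This allows a bound at an argument that is only known
  from above.\<close>

lemma poly_majorant:
  fixes p :: "real poly"
  obtains p' where "\<And>r m. 0 \<le> r \<Longrightarrow> r \<le> m \<Longrightarrow> \<bar>poly p r\<bar> \<le> poly p' m"
proof -
  have "\<exists>p'. \<forall>r m. 0 \<le> r \<longrightarrow> r \<le> m \<longrightarrow> \<bar>poly p r\<bar> \<le> poly p' m"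
  proof (induction p)
    case 0
    show ?case by (intro exI[of _ 0]) simp
  next
    case (pCons a p)
    then obtain p' where p': "\<And>r m. 0 \<le> r \<Longrightarrow> r \<le> m \<Longrightarrow> \<bar>poly p r\<bar> \<le> poly p' m" by blast
    show ?case
    proof (intro exI[of _ "pCons \<bar>a\<bar> p'"] allI impI)
      fix r m :: real assume rm: "0 \<le> r" "r \<le> m"
      have "\<bar>r * poly p r\<bar> \<le> m * poly p' m"
        unfolding abs_mult using rm p'[OF rm] by (intro mult_mono) auto
      then show "\<bar>poly (pCons a p) r\<bar> \<le> poly (pCons \<bar>a\<bar> p') m" by simp
    qed
  qed
  then show ?thesis using that by blast
qed


section \<open>Magnitude of numbers with short encodings\<close>

lemma two_abs_le_int_length: "2 * \<bar>real_of_int z\<bar> \<le> 2 ^ int_length z"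
proof -
  have "nat \<bar>z\<bar> < 2 ^ floorlog 2 (nat \<bar>z\<bar>)" by (rule floorlog_leD) auto
  then have "real (nat \<bar>z\<bar>) \<le> real (2 ^ floorlog 2 (nat \<bar>z\<bar>))"
    by (simp only: of_nat_le_iff less_imp_le)
  then show ?thesis by (simp add: int_length_def)
qed

text \<open>The number \<open>D\<close> is the denominator of \<open>r\<close>. The summand 1 next to \<open>\<bar>r\<bar>\<close> makes the bound
  multiplicative: with it, sums of rationals are dominated by products of powers of two.\<close>

lemma rat_length_bounds:
  obtains D :: nat where "1 \<le> D" "real D \<le> 2 ^ rat_length r" "real_of_rat r * real D \<in> \<int>"
    "1 + \<bar>real_of_rat r\<bar> \<le> 2 ^ rat_length r"
proof -
  obtain p q where pq: "quotient_of r = (p, q)" by (cases "quotient_of r")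
  have q: "q > 0" using quotient_of_denom_pos[OF pq] .
  have r: "real_of_rat r = real_of_int p / real_of_int q"
    using quotient_of_div[OF pq] by (simp add: of_rat_divide)
  have len: "rat_length r = int_length p + int_length q" by (simp add: rat_length_def pq)
  have pos: "1 \<le> int_length z" for z by (simp add: int_length_def)
  have pow: "(2 :: real) \<le> 2 ^ int_length z" for z
    using power_increasing[OF pos, of "2::real" z] by simp
  have nat_q: "real (nat q) = real_of_int q" using q by simp
  have "real (nat q) \<le> 1 * 2 ^ int_length q"
    unfolding nat_q using two_abs_le_int_length[of q] q by linarith
  also have "\<dots> \<le> 2 ^ int_length p * 2 ^ int_length q"
    using pow[of p] by (intro mult_right_mono) auto
  finally have D: "real (nat q) \<le> 2 ^ rat_length r" by (simp add: len power_add)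
  have "\<bar>real_of_rat r\<bar> \<le> \<bar>real_of_int p\<bar>"
    unfolding r using q by (simp add: abs_divide divide_le_eq mult_le_cancel_left1)
  then have "1 + \<bar>real_of_rat r\<bar> \<le> 2 ^ int_length p * 2"
    using two_abs_le_int_length[of p] pow[of p] by linarith
  also have "\<dots> \<le> 2 ^ int_length p * 2 ^ int_length q" using pow[of q] by (intro mult_left_mono) auto
  finally have "1 + \<bar>real_of_rat r\<bar> \<le> 2 ^ rat_length r" by (simp add: len power_add)
  moreover have "real_of_rat r * real (nat q) \<in> \<int>" using q by (simp add: r)
  ultimately show ?thesis using that[of "nat q"] q D by linarith
qed

text \<open>Multiplied by all denominators, a scalar product \<open>y\<close> of rational vectors becomes an integer.
  If it is positive, it is at least 1, so \<open>y\<close> is at least the inverse of the product of the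
  denominators, which is at least \<open>2 ^ - s\<close>. Conversely \<open>y \<le> 2 ^ s\<close>, because a sum of nonnegative
  \<open>t\<^sub>j\<close> is at most the product of the \<open>1 + t\<^sub>j\<close>.\<close>

lemma scalar_product_magnitude:
  fixes a b :: "nat \<Rightarrow> rat" and n :: nat
  defines "y \<equiv> \<Sum>j<n. real_of_rat (a j) * real_of_rat (b j)"
    and "s \<equiv> \<Sum>j<n. rat_length (a j) + rat_length (b j)"
  assumes "0 < y"
  shows "\<bar>ln y\<bar> \<le> real s"
proof -
  define D where "D r = (SOME D :: nat. 1 \<le> D \<and> real D \<le> 2 ^ rat_length r \<and> real_of_rat r * real D \<in> \<int>)" for r
  have D: "1 \<le> D r \<and> real (D r) \<le> 2 ^ rat_length r \<and> real_of_rat r * real (D r) \<in> \<int>" for r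
    unfolding D_def by (rule someI_ex) (metis rat_length_bounds)
  have size: "1 + \<bar>real_of_rat r\<bar> \<le> 2 ^ rat_length r" for r
    by (metis rat_length_bounds)
  define E where "E j = real (D (a j)) * real (D (b j))" for j
  have E1: "1 \<le> E j" for j
  proof -
    have "1 * 1 \<le> E j" unfolding E_def using D by (intro mult_mono) auto
    then show ?thesis by simp
  qed
  have E0: "0 \<le> E j" for j using E1[of j] by linarith
  have E2: "E j \<le> 2 ^ (rat_length (a j) + rat_length (b j))" for j
    unfolding E_def power_add using D by (intro mult_mono) auto
  have Eint: "E j \<in> \<int>" for j by (simp add: E_def)
  have "(\<Prod>j<n. E j) \<le> (\<Prod>j<n. 2 ^ (rat_length (a j) + rat_length (b j)))"
    by (rule prod_mono) (use E0 E2 in auto)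
  then have prodE: "(\<Prod>j<n. E j) \<le> 2 ^ s" by (simp add: power_sum s_def)
  have prodE1: "1 \<le> (\<Prod>j<n. E j)" by (rule prod_ge_1) (use E1 in auto)
  \<comment> \<open>In the \<open>j\<close>-th summand, the factor \<open>E j\<close> clears the denominators.\<close>
  have "y * (\<Prod>j<n. E j) \<in> \<int>"
    unfolding y_def sum_distrib_right
  proof (rule Ints_sum)
    fix j assume j: "j \<in> {..<n}"
    have "real_of_rat (a j) * real_of_rat (b j) * (\<Prod>j<n. E j) =
        (real_of_rat (a j) * real (D (a j))) * (real_of_rat (b j) * real (D (b j))) *
        (\<Prod>j\<in>{..<n} - {j}. E j)"
      by (subst prod.remove[OF _ j]) (simp_all add: E_def mult_ac)
    also have "\<dots> \<in> \<int>"
      using D[of "a j"] D[of "b j"] Eint by (intro Ints_mult[OF Ints_mult] Ints_prod) blast+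
    finally show "real_of_rat (a j) * real_of_rat (b j) * (\<Prod>j<n. E j) \<in> \<int>" .
  qed
  moreover have "0 < y * (\<Prod>j<n. E j)" using assms(3) prodE1 by (intro mult_pos_pos) linarith+
  ultimately have "1 \<le> y * (\<Prod>j<n. E j)" by (auto simp: Ints_def)
  also have "\<dots> \<le> y * 2 ^ s" using prodE assms(3) by (intro mult_left_mono) auto
  finally have lower: "1 \<le> y * 2 ^ s" .
  have "y \<le> (\<Prod>j<n. 1 + \<bar>real_of_rat (a j) * real_of_rat (b j)\<bar>)"
  proof -
    have "y \<le> (\<Sum>j<n. \<bar>real_of_rat (a j) * real_of_rat (b j)\<bar>)"
      unfolding y_def by (intro sum_mono) auto
    also have "\<dots> \<le> (\<Prod>j<n. 1 + \<bar>real_of_rat (a j) * real_of_rat (b j)\<bar>)"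
      by (rule sum_le_prod) auto
    finally show ?thesis .
  qed
  also have "\<dots> \<le> (\<Prod>j<n. 2 ^ (rat_length (a j) + rat_length (b j)))"
  proof (rule prod_mono, intro conjI)
    fix j
    have "1 + \<bar>real_of_rat (a j) * real_of_rat (b j)\<bar> \<le>
        (1 + \<bar>real_of_rat (a j)\<bar>) * (1 + \<bar>real_of_rat (b j)\<bar>)"
      by (simp add: abs_mult algebra_simps)
    also have "\<dots> \<le> 2 ^ rat_length (a j) * 2 ^ rat_length (b j)"
      using size by (intro mult_mono) auto
    finally show "1 + \<bar>real_of_rat (a j) * real_of_rat (b j)\<bar> \<le> 2 ^ (rat_length (a j) + rat_length (b j))"
      by (simp add: power_add)
  qed auto
  also have "\<dots> = 2 ^ s" by (simp add: power_sum s_def)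
  finally have upper: "y \<le> 2 ^ s" .
  have "ln y \<le> ln (2 ^ s)" using upper assms(3) by simp
  moreover have "0 \<le> ln (y * 2 ^ s)" using lower by simp
  then have "0 \<le> ln y + ln (2 ^ s)" using assms(3) by (simp add: ln_mult)
  moreover have "ln (2 ^ s :: real) \<le> real s * 1"
    unfolding ln_realpow using ln_le_minus_one[of "2 :: real"] by (intro mult_left_mono) auto
  ultimately show ?thesis by linarith
qed


section \<open>A multiplicative grid on the orthant\<close>

text \<open>The cells are boxes whose sides are the intervals between consecutive powers of \<open>1 + \<epsilon>\<close>.
  The value 0 lies in no such interval, so it gets the index \<open>None\<close>.\<close>

definition cell :: "real \<Rightarrow> real ^ 'd::finite \<Rightarrow> 'd \<Rightarrow> int option" where
  "cell \<epsilon> y = (\<lambda>i. if y $ i = 0 then None else Some \<lfloor>ln (y $ i) / ln (1 + \<epsilon>)\<rfloor>)"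

text \<open>Here \<open>e\<close> stands for \<open>1 / \<epsilon>\<close>. A coordinate whose logarithm is at most \<open>L\<close> in absolute value
  has an index of absolute value at most \<open>L / ln (1 + \<epsilon>) \<le> L * (1 + e)\<close>, up to rounding; the 4
  pays for rounding at both ends, the index 0 and \<open>None\<close>.\<close>

definition num_cells :: "nat \<Rightarrow> real \<Rightarrow> real \<Rightarrow> real" where
  "num_cells d L e = (2 * L * (1 + e) + 4) ^ d"

lemma same_cell_imp_le:
  fixes y y' :: "real ^ 'd::finite"
  assumes "0 < \<epsilon>" "y \<in> orthant" "y' \<in> orthant" "cell \<epsilon> y = cell \<epsilon> y'"
  shows "y $ i \<le> (1 + \<epsilon>) * y' $ i"
proof (cases "y $ i = 0")
  case True
  then show ?thesis using assms(1,3) by (simp add: orthant_def)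
next
  case False
  have eq: "cell \<epsilon> y i = cell \<epsilon> y' i" using assms(4) by simp
  then have ne: "y' $ i \<noteq> 0" using False by (auto simp: cell_def split: if_splits)
  then have pos: "0 < y $ i" "0 < y' $ i"
    using False assms(2,3) by (auto simp: orthant_def less_le)
  have "\<lfloor>ln (y $ i) / ln (1 + \<epsilon>)\<rfloor> = \<lfloor>ln (y' $ i) / ln (1 + \<epsilon>)\<rfloor>"
    using eq False ne by (simp add: cell_def)
  then have "ln (y $ i) / ln (1 + \<epsilon>) \<le> ln (y' $ i) / ln (1 + \<epsilon>) + 1" by linarith
  then have "ln (y $ i) \<le> ln (y' $ i) + ln (1 + \<epsilon>)"
    using assms(1) by (simp add: field_simps)
  also have "\<dots> = ln ((1 + \<epsilon>) * y' $ i)" using pos assms(1) by (simp add: ln_mult)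
  finally show ?thesis using pos assms(1) by (simp add: ln_le_cancel_iff)
qed

lemma inverse_ln_le:
  fixes \<epsilon> :: real
  assumes "0 < \<epsilon>"
  shows "1 / ln (1 + \<epsilon>) \<le> 1 + 1 / \<epsilon>"
proof -
  have "ln (1 / (1 + \<epsilon>)) \<le> 1 / (1 + \<epsilon>) - 1" by (rule ln_le_minus_one) (use assms in simp)
  then have "\<epsilon> / (1 + \<epsilon>) \<le> ln (1 + \<epsilon>)" using assms by (simp add: ln_div field_simps)
  then have "1 / ln (1 + \<epsilon>) \<le> 1 / (\<epsilon> / (1 + \<epsilon>))"
    using assms by (intro divide_left_mono mult_pos_pos) auto
  then show ?thesis using assms by (simp add: field_simps)
qed

lemma card_le_num_cells:
  fixes Y :: "(real ^ 'd::finite) set"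
  assumes "0 < \<epsilon>" and inj: "inj_on (cell \<epsilon>) Y"
    and L: "\<And>y i. y \<in> Y \<Longrightarrow> y $ i \<noteq> 0 \<Longrightarrow> \<bar>ln (y $ i)\<bar> \<le> L" and L0: "0 \<le> L"
  shows "real (card Y) \<le> num_cells CARD('d) L (1 / \<epsilon>)"
proof -
  define a where "a = \<lceil>L * (1 + 1 / \<epsilon>)\<rceil>"
  have Le: "0 \<le> L * (1 + 1 / \<epsilon>)" using assms(1) L0 by simp
  then have a0: "0 \<le> a" by (simp add: a_def)
  define V where "V = insert None (Some ` {- a..a})"
  have "card (Some ` {- a..a}) = nat (2 * a + 1)" by (subst card_image) (use a0 in auto)
  then have cV: "card V = nat (2 * a + 1) + 1" unfolding V_def by (subst card_insert_disjoint) auto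
  have fV: "finite V" by (simp add: V_def)
  have "cell \<epsilon> ` Y \<subseteq> PiE UNIV (\<lambda>_. V)"
  proof (rule image_subsetI, rule PiE_I)
    fix y i assume y: "y \<in> Y"
    show "cell \<epsilon> y i \<in> V"
    proof (cases "y $ i = 0")
      case True
      then show ?thesis by (simp add: cell_def V_def)
    next
      case False
      have ln: "0 < ln (1 + \<epsilon>)" using assms(1) by simp
      have "\<bar>ln (y $ i) / ln (1 + \<epsilon>)\<bar> = \<bar>ln (y $ i)\<bar> * (1 / ln (1 + \<epsilon>))" using ln by simp
      also have "\<dots> \<le> L * (1 + 1 / \<epsilon>)"
        using L[OF y False] inverse_ln_le[OF assms(1)] ln L0 by (intro mult_mono) auto
      also have "\<dots> \<le> of_int a" by (simp add: a_def)
      finally have "\<bar>ln (y $ i) / ln (1 + \<epsilon>)\<bar> \<le> of_int a" .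
      then have "- a \<le> \<lfloor>ln (y $ i) / ln (1 + \<epsilon>)\<rfloor>" "\<lfloor>ln (y $ i) / ln (1 + \<epsilon>)\<rfloor> \<le> a" by linarith+
      then show ?thesis using False by (simp add: cell_def V_def)
    qed
  qed simp
  then have "card (cell \<epsilon> ` Y) \<le> card (PiE (UNIV :: 'd set) (\<lambda>_. V))"
    using fV by (intro card_mono finite_PiE) auto
  then have "card Y \<le> card V ^ CARD('d)" by (simp add: card_image[OF inj] card_PiE)
  then have "real (card Y) \<le> real (card V) ^ CARD('d)" by (metis of_nat_le_iff of_nat_power)
  also have "\<dots> \<le> num_cells CARD('d) L (1 / \<epsilon>)"
    unfolding num_cells_def
  proof (rule power_mono)
    have "real (card V) = 2 * of_int a + 2" using a0 by (simp add: cV)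
    moreover have "of_int a \<le> L * (1 + 1 / \<epsilon>) + 1" unfolding a_def by linarith
    ultimately show "real (card V) \<le> 2 * L * (1 + 1 / \<epsilon>) + 4"
      unfolding mult.assoc by linarith
  qed simp
  finally show ?thesis .
qed

text \<open>A point \<open>y'\<close> in the cell of \<open>y\<close> would satisfy \<open>y \<le> (1 + \<epsilon>) y'\<close> in each coordinate. As \<open>w\<close> is
  nonnegative, a cut that is valid for \<open>y\<close> would then remain valid for \<open>y'\<close> after relaxation.\<close>

lemma separated_imp_cell_neq:
  fixes y y' w :: "real ^ 'd::finite"
  assumes "0 < \<epsilon>" "y \<in> orthant" "y' \<in> orthant" "w \<in> orthant"
    and "c \<le> w \<bullet> y" "((1 + \<epsilon>) *\<^sub>R w) \<bullet> y' < c"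
  shows "cell \<epsilon> y \<noteq> cell \<epsilon> y'"
proof
  assume eq: "cell \<epsilon> y = cell \<epsilon> y'"
  have "w \<bullet> y \<le> (\<Sum>i\<in>UNIV. w $ i * ((1 + \<epsilon>) * y' $ i))"
    unfolding inner_vec_def inner_real_def
    using same_cell_imp_le[OF assms(1-3) eq] assms(4)
    by (intro sum_mono mult_left_mono) (auto simp: orthant_def)
  also have "\<dots> = ((1 + \<epsilon>) *\<^sub>R w) \<bullet> y'"
    by (simp add: inner_vec_def mult_ac)
  finally show False using assms(5,6) by linarith
qed


section \<open>Facets of inner approximations\<close>

lemma facet_halfspace_normal:
  fixes ys :: "(real ^ 'd::finite) list"
  assumes H: "halfspace w c \<in> facet_halfspaces (inner_approx (set ys))" and ne: "ys \<noteq> []"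
  shows "w \<in> orthant" "w \<noteq> 0" "\<And>y. y \<in> set ys \<Longrightarrow> c \<le> w \<bullet> y"
proof -
  have sub: "inner_approx (set ys) \<subseteq> halfspace w c"
    using H by (simp add: facet_halfspaces_def)
  have "supports ys (w, c)" by (rule supports_if[OF ne sub])
  then show "w \<in> orthant" "\<And>y. y \<in> set ys \<Longrightarrow> c \<le> w \<bullet> y" by (auto simp: supports_iff)
  show "w \<noteq> 0"
  proof
    assume "w = 0"
    then have "halfspace w c = {} \<or> halfspace w c = UNIV" by (auto simp: halfspace_def)
    then have "frontier (halfspace w c) = {}" by auto
    then show False using H by (auto simp: facet_halfspaces_def facet_of_def)
  qed
qed

lemma length_concat_candidates:
  "length (concat (map candidate xs)) \<le> length xs"
  by (induction xs) (auto simp: candidate_def)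

text \<open>A bound on the running time does not bound the length of the result. But the halfspaces are
  listed without repetition, so every facet enumeration returns equally many of them, and for
  brute force their number is at most that of the systems it solves.\<close>

lemma facet_enumeration_length:
  fixes fe :: "'d::finite facet_enum"
  assumes "facet_enumeration fe" "ys \<noteq> []"
  shows "length (result (fe ys)) \<le> (length ys + CARD('d)) ^ CARD('d)"
proof -
  let ?H = "\<lambda>(w :: real ^ 'd, c). halfspace w c"
  have card: "length (result g) = card (facet_halfspaces (inner_approx (set ys)))"
    if "g = f ys" "facet_enumeration f" for f g
    using that assms(2) unfolding facet_enumeration_def Let_def by (metis distinct_card length_map)
  have "length (axes :: 'd list) = CARD('d)" using axes by (metis distinct_card)
  then have gen: "length (generators ys) = length ys + CARD('d)" by (simp add: generators_def)
  have "length (result (fe ys)) = length (result (brute_force ys))"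
    using card[OF refl assms(1)] card[OF refl facet_enumeration_brute_force] by simp
  also have "\<dots> \<le> length (concat (map candidate (List.n_lists CARD('d) (generators ys))))"
    unfolding brute_force_def Let_def timed.sel
    by (rule order_trans[OF length_remdups_leq length_filter_le])
  also have "\<dots> \<le> (length ys + CARD('d)) ^ CARD('d)"
    using length_concat_candidates[of "List.n_lists CARD('d) (generators ys)"]
    by (simp add: length_n_lists gen)
  finally show ?thesis .
qed


section \<open>Runs of the inner approximation algorithm\<close>

text \<open>In these bounds, \<open>m\<close> is a bound on the number of points, \<open>L\<close> a bound on encoding lengths,
  \<open>T\<close> one on the time of an oracle call, and \<open>q\<close> the time of facet enumeration. The factor
  \<open>facet_bound d m * m\<close> is a bound on the number of finished halfspaces.\<close>

definition facet_bound :: "nat \<Rightarrow> real \<Rightarrow> real" where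
  "facet_bound d m = (m + real d) ^ d"

definition step_bound :: "nat \<Rightarrow> real poly \<Rightarrow> real \<Rightarrow> real \<Rightarrow> real \<Rightarrow> real" where
  "step_bound d q L m T =
     (1 + 5 * (real d + 1) * facet_bound d m * (facet_bound d m * m)) + (1 + real d) + T + L + poly q m"

definition run_bound :: "nat \<Rightarrow> real poly \<Rightarrow> real \<Rightarrow> real \<Rightarrow> real \<Rightarrow> real" where
  "run_bound d q L e T =
     (let m = num_cells d L e in step_bound d q L m T * (m + facet_bound d m * m + 1))"

text \<open>The encoding of a matrix entry takes at least one bit for its numerator and one for its
  denominator, so twice the number of entries, the cost of an evaluation, is at most the encoding length.\<close>

lemma eval_cost_le_obj_length:
  fixes I :: "'d::finite momilp"
  shows "eval_cost I \<le> obj_length I"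
proof -
  have "(\<Sum>i\<in>(UNIV :: 'd set). \<Sum>j<n_vars I. 2) \<le> obj_length I"
    unfolding obj_length_def by (intro sum_mono) (simp add: rat_length_def int_length_def)
  then show ?thesis by (simp add: eval_cost_def mult_ac)
qed

lemma ln_objective_le:
  fixes I :: "'d::finite momilp"
  assumes "0 < objective I (real_sol x) $ i"
  shows "\<bar>ln (objective I (real_sol x) $ i)\<bar> \<le> real (obj_length I + sol_length I x)"
proof -
  have "\<bar>ln (objective I (real_sol x) $ i)\<bar> \<le>
      real (\<Sum>j<n_vars I. rat_length (obj I i j) + rat_length (x j))"
    using assms scalar_product_magnitude[of "obj I i" x "n_vars I"] by (simp add: objective_def)
  also have "(\<Sum>j<n_vars I. rat_length (obj I i j) + rat_length (x j)) \<le>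
      obj_length I + sol_length I x"
    unfolding sum.distrib sol_length_def obj_length_def
    by (intro add_right_mono member_le_sum[of i UNIV "\<lambda>i. \<Sum>j<n_vars I. rat_length (obj I i j)"]) auto
  finally show ?thesis by (simp only: of_nat_le_iff)
qed

text \<open>One run of the algorithm: \<open>B\<close> bounds the encoding lengths of solutions and \<open>L\<close> the encoding
  lengths that enter into objective values. The bounds on the numbers of points \<open>m\<close> and of facets
  \<open>K\<close>, and on the time \<open>S\<close> of one iteration, are parameters tied by equations so that they can be
  kept folded.\<close>

locale approximation_run =
  fixes I :: "'d::finite momilp" and \<epsilon> :: real and hpO :: "'d hp_oracle" and fe :: "'d facet_enum"
    and B L :: real and T :: nat and q :: "real poly" and m K S :: real
  assumes eps: "0 < \<epsilon>"
    and images_orthant: "images I \<subseteq> orthant"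
    and answers: "plane_separating_oracle I B hpO"
    and answer_time: "oracle_time_le hpO T"
    and fe: "facet_enumeration fe"
    and fe_time: "\<And>ys r. ys \<noteq> [] \<Longrightarrow> real (length ys) \<le> r \<Longrightarrow> real (steps (fe ys)) \<le> poly q r"
    and L: "real (obj_length I) + B \<le> L" and B: "0 \<le> B"
    and m_eq: "m = num_cells CARD('d) L (1 / \<epsilon>)"
    and K_eq: "K = facet_bound CARD('d) m"
    and S_eq: "S = step_bound CARD('d) q L m (real T)"
begin


definition found :: "solution \<Rightarrow> bool" where
  "found x \<longleftrightarrow> real_sol x \<in> feasible I \<and> real (sol_length I x) \<le> B"

definition separated :: "solution list \<Rightarrow> bool" where
  "separated R \<longleftrightarrow> R \<noteq> [] \<and> (\<forall>x\<in>set R. found x) \<and> distinct (map (cell \<epsilon>) (points I R))"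

definition lists_facets :: "((real ^ 'd) \<times> real) list \<Rightarrow> solution list \<Rightarrow> bool" where
  "lists_facets Hs R \<longleftrightarrow> real (length Hs) \<le> K \<and>
     (\<forall>(w, c)\<in>set Hs. halfspace w c \<in> facet_halfspaces (inner_approx (set (points I R))))"

text \<open>The length of \<open>F\<close> alone has no inductive bound, because \<open>F\<close> also keeps halfspaces that have
  ceased to be facets. Adding the number of open halfspaces gives a potential that does not
  increase when a halfspace is finished, and increases by at most \<open>K\<close> with each new point.
  Each iteration adds one element to \<open>R\<close> or to \<open>F\<close>, so the time is charged to their lengths. The
  additional \<open>1\<close> in the bound at \<open>Halt\<close> pays for the last, unsuccessful search.\<close>

fun invariant :: "'d state \<Rightarrow> bool" where
  "invariant (Loop R Hs F t) \<longleftrightarrow> separated R \<and> lists_facets Hs R \<and>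
     real (length F + card (open_halfspaces Hs F)) \<le> K * real (length R) \<and>
     real t \<le> S * real (length R + length F)"
| "invariant (Halt R t) \<longleftrightarrow> real t \<le> S * (m + K * m + 1)"

text \<open>The measure that bounds the number of iterations. No step starts at
  \<open>Halt\<close>, so any value there that respects the bound will do.\<close>

fun progress :: "'d state \<Rightarrow> nat" where
  "progress (Loop R Hs F t) = length R + length F"
| "progress (Halt R t) = 0"

lemma found_orthant: "found x \<Longrightarrow> objective I (real_sol x) \<in> orthant"
  using images_orthant by (auto simp: found_def images_def)

lemma length_separated:
  assumes "separated R"
  shows "real (length R) \<le> m"
proof -
  have dist: "distinct (points I R)" and inj: "inj_on (cell \<epsilon>) (set (points I R))"
    using assms unfolding separated_def distinct_map by blast+
  have "real (card (set (points I R))) \<le> m"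
  unfolding m_eq
  proof (rule card_le_num_cells[OF eps inj])
    show "0 \<le> L" using L B by linarith
    fix y i assume "y \<in> set (points I R)" and ne: "y $ i \<noteq> 0"
    then obtain x where x: "found x" "y = objective I (real_sol x)"
      using assms by (auto simp: separated_def)
    then have "0 < y $ i" using found_orthant[OF x(1)] ne by (auto simp: orthant_def less_le)
    then show "\<bar>ln (y $ i)\<bar> \<le> L"
      using ln_objective_le[of I x i] x L by (simp add: found_def)
  qed
  then show ?thesis using distinct_card[OF dist] by simp
qed

lemma lists_facets_enumeration:
  assumes "separated R"
  shows "lists_facets (result (fe (points I R))) R"
proof -
  have ne: "points I R \<noteq> []" using assms by (simp add: separated_def)
  have "length (result (fe (points I R))) \<le> (length R + CARD('d)) ^ CARD('d)"
    using facet_enumeration_length[OF fe ne] by simp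
  then have "real (length (result (fe (points I R)))) \<le> (real (length R) + real CARD('d)) ^ CARD('d)"
    by (metis of_nat_add of_nat_le_iff of_nat_power)
  also have "\<dots> \<le> K"
    unfolding K_eq facet_bound_def using length_separated[OF assms] by (intro power_mono) auto
  finally have "real (length (result (fe (points I R)))) \<le> K" .
  moreover have "set (map (\<lambda>(w, c). halfspace w c) (result (fe (points I R)))) =
      facet_halfspaces (inner_approx (set (points I R)))"
    using fe ne unfolding facet_enumeration_def Let_def by blast
  ultimately show ?thesis unfolding lists_facets_def by fastforce
qed

lemma open_halfspaces_subset: "open_halfspaces Hs F \<subseteq> set Hs"
  by (auto simp: open_halfspaces_def)

lemma card_open_halfspaces: "card (open_halfspaces Hs F) \<le> length Hs"
  using card_mono[OF finite_set open_halfspaces_subset] card_length le_trans by blast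

lemma card_open_halfspaces_Cons:
  assumes "(w, c) \<in> open_halfspaces Hs F"
  shows "card (open_halfspaces Hs ((w, c) # F)) < card (open_halfspaces Hs F)"
proof (rule psubset_card_mono)
  show "finite (open_halfspaces Hs F)" using open_halfspaces_subset finite_set by (rule finite_subset)
  show "open_halfspaces Hs ((w, c) # F) \<subset> open_halfspaces Hs F"
    using assms by (auto simp: open_halfspaces_def)
qed

text \<open>The last bound covers the most expensive kind of iteration, one that finds a new point. The
  hypotheses are the part of the invariant that does not speak of time: the time part for the
  initial state is itself derived from this bound.\<close>

lemma invariant_length_bounds:
  fixes w :: "real ^ 'd"
  assumes sep: "separated R" and Hs: "lists_facets Hs R"
    and F: "real (length F + card (open_halfspaces Hs F)) \<le> K * real (length R)"
  shows "1 \<le> m" "0 \<le> K" "real (length R) \<le> m" "real (length F) \<le> K * m" "0 \<le> poly q m"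
    "real (select_cost Hs F) + real (relax_cost w) + real T + real (eval_cost I) + poly q m \<le> S"
proof -
  have len_Hs: "real (length Hs) \<le> K" using Hs by (simp add: lists_facets_def)
  show m: "real (length R) \<le> m" by (rule length_separated[OF sep])
  have "1 \<le> length R" using sep by (cases R) (auto simp: separated_def)
  then show "1 \<le> m" using m by linarith
  show K: "0 \<le> K" using len_Hs by (rule order_trans[rotated]) simp
  have "K * real (length R) \<le> K * m" using m K by (rule mult_left_mono)
  then show F': "real (length F) \<le> K * m" using F by simp
  have "points I R \<noteq> []" using sep by (simp add: separated_def)
  from fe_time[OF this, of m] m show "0 \<le> poly q m" by simp
  have "real (select_cost Hs F) = 1 + 5 * (real CARD('d) + 1) * real (length Hs) * real (length F)"
    by (simp add: select_cost_def)
  also have "\<dots> \<le> 1 + 5 * (real CARD('d) + 1) * K * (K * m)"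
    using len_Hs F' K by (intro add_left_mono mult_mono mult_left_mono mult_nonneg_nonneg) auto
  finally have "real (select_cost Hs F) \<le> 1 + 5 * (real CARD('d) + 1) * K * (K * m)" .
  moreover have "real (eval_cost I) \<le> L"
    using eval_cost_le_obj_length[of I] L B by linarith
  ultimately show "real (select_cost Hs F) + real (relax_cost w) + real T + real (eval_cost I) + poly q m \<le> S"
    by (simp add: S_eq step_bound_def relax_cost_def flip: K_eq)
qed

lemma listed_normal:
  assumes "separated R" "lists_facets Hs R" "(w, c) \<in> set Hs"
  shows "w \<in> orthant" "(1 + \<epsilon>) *\<^sub>R w \<in> orthant \<and> (1 + \<epsilon>) *\<^sub>R w \<noteq> 0"
    "\<And>y. y \<in> set (points I R) \<Longrightarrow> c \<le> w \<bullet> y"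
proof -
  have ne: "points I R \<noteq> []" using assms(1) by (simp add: separated_def)
  have "halfspace w c \<in> facet_halfspaces (inner_approx (set (points I R)))"
    using assms(2,3) by (auto simp: lists_facets_def)
  note w = facet_halfspace_normal[OF this ne]
  show "w \<in> orthant" "\<And>y. y \<in> set (points I R) \<Longrightarrow> c \<le> w \<bullet> y" using w(1,3) .
  show "(1 + \<epsilon>) *\<^sub>R w \<in> orthant \<and> (1 + \<epsilon>) *\<^sub>R w \<noteq> 0"
    using w(1,2) eps by (auto simp: orthant_def)
qed

text \<open>A new solution violates the relaxation of a cut that is valid for all points found before,
  so its image opens a new cell of the grid. This is what bounds the number of solutions.\<close>

lemma separated_Cons:
  assumes "separated R" "lists_facets Hs R" "(w, c) \<in> set Hs"
    and ans: "result (hpO ((1 + \<epsilon>) *\<^sub>R w) c) = Not_Inside x"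
  shows "separated (x # R)"
proof -
  note w = listed_normal[OF assms(1-3)]
  from answers w(2) have "case result (hpO ((1 + \<epsilon>) *\<^sub>R w) c) of
      Inside \<Rightarrow> \<forall>x\<in>feasible I. objective I x \<in> halfspace ((1 + \<epsilon>) *\<^sub>R w) c
    | Not_Inside x \<Rightarrow> real_sol x \<in> feasible I \<and> real (sol_length I x) \<le> B \<and>
        objective I (real_sol x) \<notin> halfspace ((1 + \<epsilon>) *\<^sub>R w) c"
    unfolding plane_separating_oracle_def by blast
  then have x: "found x" "((1 + \<epsilon>) *\<^sub>R w) \<bullet> objective I (real_sol x) < c"
    by (simp_all add: ans found_def halfspace_def)
  have "cell \<epsilon> y \<noteq> cell \<epsilon> (objective I (real_sol x))" if y: "y \<in> set (points I R)" for y
  proof (rule separated_imp_cell_neq[OF eps _ found_orthant[OF x(1)] w(1) w(3)[OF y] x(2)])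
    show "y \<in> orthant" using y assms(1) found_orthant by (auto simp: separated_def)
  qed
  then show ?thesis using assms(1) x(1) by (fastforce simp: separated_def)
qed

lemma oracle_steps_le:
  assumes "separated R" "lists_facets Hs R" "(w, c) \<in> set Hs"
  shows "steps (hpO ((1 + \<epsilon>) *\<^sub>R w) c) \<le> T"
  using listed_normal(2)[OF assms] answer_time by (simp add: oracle_time_le_def)

lemma invariant_init:
  assumes "found x"
  shows "invariant (ia_init I fe x)"
proof -
  let ?ys = "points I [x]"
  let ?Hs = "result (fe ?ys)"
  have sep: "separated [x]" using assms by (simp add: separated_def)
  have Hs: "lists_facets ?Hs [x]" by (rule lists_facets_enumeration[OF sep])
  then have card: "real (card (open_halfspaces ?Hs [])) \<le> K"
    using card_open_halfspaces[of ?Hs "[]"] by (simp add: lists_facets_def)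
  have "real (length ([] :: ((real ^ 'd) \<times> real) list) + card (open_halfspaces ?Hs [])) \<le> K * real (length [x])"
    using card by simp
  note b = invariant_length_bounds[OF sep Hs this]
  have "real (steps (fe ?ys)) \<le> poly q m" using b(3) by (intro fe_time) auto
  then have "real (eval_cost I + steps (fe ?ys)) \<le> S"
    using b(6)[of 0] by linarith
  then show ?thesis using sep Hs card by (simp add: ia_init_def)
qed

lemma invariant_step:
  assumes "ia_step I \<epsilon> hpO fe s s'" "invariant s"
  shows "invariant s'"
  using assms
proof (induction rule: ia_step.induct)
  case (halt Hs F R t)
  have inv: "separated R" "lists_facets Hs R"
    "real (length F + card (open_halfspaces Hs F)) \<le> K * real (length R)"
    using halt.prems by auto
  note b = invariant_length_bounds[OF inv]
  have S: "real (select_cost Hs F) \<le> S" using b(5) b(6)[of 0] by linarith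
  then have S0: "0 \<le> S" by linarith
  have "real t \<le> S * real (length R + length F)" using halt.prems by simp
  also have "\<dots> \<le> S * (m + K * m)" using b S0 by (intro mult_left_mono) auto
  finally show ?case using S by (simp add: distrib_left)
next
  case (inside w c Hs F u R t)
  have wc: "(w, c) \<in> set Hs" using inside(1) open_halfspaces_subset by blast
  have inv: "separated R" "lists_facets Hs R"
    "real (length F + card (open_halfspaces Hs F)) \<le> K * real (length R)"
    "real t \<le> S * real (length R + length F)"
    using inside.prems by auto
  note b = invariant_length_bounds[OF inv(1-3)]
  have "u \<le> T" using oracle_steps_le[OF inv(1,2) wc] inside(2) by simp
  then have "real (select_cost Hs F) + real (relax_cost w) + real u \<le> S" using b(5) b(6)[of w] by linarith
  then have "real (t + select_cost Hs F + relax_cost w + u) \<le> S * real (length R + length ((w, c) # F))"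
    using inv(4) by (simp add: distrib_left)
  moreover have "real (length ((w, c) # F) + card (open_halfspaces Hs ((w, c) # F))) \<le> K * real (length R)"
    using card_open_halfspaces_Cons[OF inside(1)] inv(3) by (simp del: of_nat_add)
  ultimately show ?case using inv(1,2) by (simp only: invariant.simps)
next
  case (not_inside w c Hs F x u R Hs' v t)
  have wc: "(w, c) \<in> set Hs" using not_inside(1) open_halfspaces_subset by blast
  have inv: "separated R" "lists_facets Hs R"
    "real (length F + card (open_halfspaces Hs F)) \<le> K * real (length R)"
    "real t \<le> S * real (length R + length F)"
    using not_inside.prems by auto
  note b = invariant_length_bounds[OF inv(1-3)]
  have sep: "separated (x # R)" by (rule separated_Cons[OF inv(1,2) wc]) (simp add: not_inside(2))
  have Hs': "lists_facets Hs' (x # R)"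
    using lists_facets_enumeration[OF sep] not_inside(3) by simp
  have "u \<le> T" using oracle_steps_le[OF inv(1,2) wc] not_inside(2) by simp
  moreover have "real v \<le> poly q m"
    using fe_time[of "points I (x # R)" m] length_separated[OF sep] not_inside(3) by simp
  ultimately have "real (select_cost Hs F) + real (relax_cost w) + real u + real (eval_cost I) + real v \<le> S"
    using b(6)[of w] by linarith
  then have "real (t + select_cost Hs F + relax_cost w + u + eval_cost I + v) \<le>
      S * real (length (x # R) + length F)"
    using inv(4) by (simp add: distrib_left)
  moreover have "real (card (open_halfspaces Hs' F)) \<le> K"
    using Hs' card_open_halfspaces[of Hs' F] by (simp add: lists_facets_def)
  then have "real (length F + card (open_halfspaces Hs' F)) \<le> K * real (length (x # R))"
    using inv(3) by (simp add: distrib_left)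
  ultimately show ?case using sep Hs' by (simp only: invariant.simps)
qed

text \<open>The second step excludes that \<open>s'\<close> is a halting state, where the measure drops.\<close>

lemma ia_step_progress:
  assumes "ia_step I \<epsilon> hpO fe s s'" "ia_step I \<epsilon> hpO fe s' s''"
  shows "progress s < progress s'"
  using assms by (auto elim!: ia_step.cases)

lemma progress_bound:
  assumes "invariant s" "1 \<le> m" "0 \<le> K"
  shows "real (progress s) \<le> m + K * m"
proof (cases s)
  case (Loop R Hs F t)
  then show ?thesis using invariant_length_bounds[of R Hs F] assms(1) by simp
next
  case (Halt R t)
  then show ?thesis using assms(2,3) by simp
qed

lemma elapsed_bound:
  assumes "invariant s" "0 \<le> S"
  shows "real (elapsed s) \<le> S * (m + K * m + 1)"
proof (cases s)
  case (Loop R Hs F t)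
  have inv: "separated R" "lists_facets Hs R"
    "real (length F + card (open_halfspaces Hs F)) \<le> K * real (length R)"
    using assms(1) Loop by auto
  note b = invariant_length_bounds[OF inv]
  have "real t \<le> S * real (length R + length F)" using assms(1) Loop by simp
  also have "\<dots> \<le> S * (m + K * m + 1)" using b(3,4) assms by (intro mult_left_mono) auto
  finally show ?thesis using Loop by simp
next
  case (Halt R t)
  then show ?thesis using assms(1) by simp
qed

theorem running_time:
  assumes "found x"
  shows "ia_running_time_le I x \<epsilon> hpO fe (S * (m + K * m + 1))"
proof -
  have init: "invariant (ia_init I fe x)" by (rule invariant_init[OF assms])
  have reach: "invariant s" if "(ia_step I \<epsilon> hpO fe)\<^sup>*\<^sup>* (ia_init I fe x) s" for s
    using that by (induction rule: rtranclp_induct) (auto intro: init invariant_step)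
  have inv: "separated [x]" "lists_facets (result (fe (points I [x]))) [x]"
    "real (length ([] :: ((real ^ 'd) \<times> real) list) +
      card (open_halfspaces (result (fe (points I [x]))) [])) \<le> K * real (length [x])"
    using init unfolding ia_init_def invariant.simps by blast+
  note b = invariant_length_bounds[OF inv]
  have S0: "0 \<le> S" using b(5) b(6)[of 0] by linarith
  have "\<nexists>\<sigma>. \<sigma> 0 = ia_init I fe x \<and> (\<forall>k. ia_step I \<epsilon> hpO fe (\<sigma> k) (\<sigma> (Suc k)))"
  proof
    assume "\<exists>\<sigma>. \<sigma> 0 = ia_init I fe x \<and> (\<forall>k. ia_step I \<epsilon> hpO fe (\<sigma> k) (\<sigma> (Suc k)))"
    then obtain \<sigma> where 0: "\<sigma> 0 = ia_init I fe x" and step: "\<And>k. ia_step I \<epsilon> hpO fe (\<sigma> k) (\<sigma> (Suc k))"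
      by blast
    have inv: "invariant (\<sigma> k)" for k
      by (induction k) (auto simp: 0 init intro: invariant_step[OF step])
    have "k \<le> progress (\<sigma> k)" for k
      by (induction k) (auto intro: le_less_trans Suc_leI ia_step_progress[OF step step])
    then have "real k \<le> m + K * m" for k
      using progress_bound[OF inv b(1,2), of k] by (meson of_nat_mono order_trans)
    then show False using reals_Archimedean2[of "m + K * m"] by (meson not_less)
  qed
  then show ?thesis
    unfolding ia_running_time_le_def using elapsed_bound[OF reach S0] by blast
qed

end

lemma poly_bounded_run_bound:
  "poly_bounded (\<lambda>x y z. run_bound d q (poly p x) y z)"
  unfolding run_bound_def step_bound_def facet_bound_def num_cells_def Let_def
  by (intro poly_bounded_intros)

theorem theorem8:
  fixes momilp :: "'i \<Rightarrow> 'd::finite momilp"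
    and len :: "'i \<Rightarrow> nat"
    and pQ px pO :: "real poly"
    and fe :: "'d facet_enum"
  assumes objective_encoding: "\<And>I. real (obj_length (momilp I)) \<le> poly pQ (real (len I))"
    and fe: "facet_enumeration fe" "polynomial_time_enum fe"
  shows "\<exists>C N. \<forall>(I :: 'i) (\<epsilon> :: real) (hpO :: 'd hp_oracle) (x_init :: solution) (T_hpO :: nat).
           is_momilp (momilp I) \<longrightarrow>
           0 < \<epsilon> \<longrightarrow>
           plane_separating_oracle (momilp I) (poly pO (real (len I))) hpO \<longrightarrow>
           oracle_time_le hpO T_hpO \<longrightarrow>
           real_sol x_init \<in> feasible (momilp I) \<longrightarrow>
           real (sol_length (momilp I) x_init) \<le> poly px (real (len I)) \<longrightarrow>
           ia_running_time_le (momilp I) x_init \<epsilon> hpO fe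
             (poly3 C N (real (len I)) (1 / \<epsilon>) (real T_hpO))"
proof -
  obtain q where q: "\<And>ys. ys \<noteq> [] \<Longrightarrow> real (steps (fe ys)) \<le> poly q (real (length ys))"
    using fe(2) unfolding polynomial_time_enum_def by blast
  obtain q' where q': "\<And>r m. 0 \<le> r \<Longrightarrow> r \<le> m \<Longrightarrow> \<bar>poly q r\<bar> \<le> poly q' m"
    using poly_majorant by blast
  obtain px' where px': "\<And>r m. 0 \<le> r \<Longrightarrow> r \<le> m \<Longrightarrow> \<bar>poly px r\<bar> \<le> poly px' m"
    using poly_majorant by blast
  obtain pO' where pO': "\<And>r m. 0 \<le> r \<Longrightarrow> r \<le> m \<Longrightarrow> \<bar>poly pO r\<bar> \<le> poly pO' m"
    using poly_majorant by blast
  define p where "p = pQ + (px' + pO')"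
  obtain C N where CN: "\<And>x y z. 0 \<le> x \<Longrightarrow> 0 \<le> y \<Longrightarrow> 0 \<le> z \<Longrightarrow>
      run_bound CARD('d) q' (poly p x) y z \<le> poly3 C N x y z"
    using poly_bounded_imp_poly3[OF poly_bounded_run_bound[of "CARD('d)" q' p]] by blast
  show ?thesis
  proof (intro exI allI impI)
    fix I and \<epsilon> :: real and hpO :: "'d hp_oracle" and x_init T_hpO
    assume momilp: "is_momilp (momilp I)" and eps: "0 < \<epsilon>"
      and answers: "plane_separating_oracle (momilp I) (poly pO (real (len I))) hpO"
      and time: "oracle_time_le hpO T_hpO"
      and feas: "real_sol x_init \<in> feasible (momilp I)"
      and short: "real (sol_length (momilp I) x_init) \<le> poly px (real (len I))"
    let ?x = "real (len I)"
    let ?B = "poly px' ?x + poly pO' ?x"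
    have px: "\<bar>poly px ?x\<bar> \<le> poly px' ?x" and pO: "\<bar>poly pO ?x\<bar> \<le> poly pO' ?x"
      using px' pO' by auto
    then have short_le: "poly px ?x \<le> ?B" "poly pO ?x \<le> ?B" "0 \<le> ?B" by linarith+
    define m where "m = num_cells CARD('d) (poly p ?x) (1 / \<epsilon>)"
    define K where "K = facet_bound CARD('d) m"
    define S where "S = step_bound CARD('d) q' (poly p ?x) m (real T_hpO)"
    \<comment> \<open>The initial solution and those of the oracle have different length bounds; \<open>?B\<close> covers both.\<close>
    interpret approximation_run "momilp I" \<epsilon> hpO fe ?B "poly p ?x" T_hpO q' m K S
    proof
      show "images (momilp I) \<subseteq> orthant" using momilp by (simp add: is_momilp_def)
      show "plane_separating_oracle (momilp I) ?B hpO"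
        using answers short_le(2) unfolding plane_separating_oracle_def
        by (fastforce split: answer.splits)
      show "real (obj_length (momilp I)) + ?B \<le> poly p ?x"
        using objective_encoding[of I] by (simp add: p_def)
      show "real (steps (fe ys)) \<le> poly q' r" if "ys \<noteq> []" "real (length ys) \<le> r" for ys r
        using q[OF that(1)] q'[OF _ that(2)] by (smt (verit) of_nat_0_le_iff)
    qed (fact eps time fe(1) short_le(3) m_def K_def S_def)+
    have "found x_init" using feas order_trans[OF short short_le(1)] by (simp add: found_def)
    from running_time[OF this]
    show "ia_running_time_le (momilp I) x_init \<epsilon> hpO fe (poly3 C N ?x (1 / \<epsilon>) (real T_hpO))"
      using CN[of ?x "1 / \<epsilon>" "real T_hpO"] eps
      unfolding ia_running_time_le_def run_bound_def Let_def m_def K_def S_def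
      by (auto intro: order_trans)
  qed
qed

end
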